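(* Let $X$ be a path-connected space, $x_0\in X$, and suppose $N\leq\pi_1(X,x_0)$ is a subgroup containing the commutator subgroup of $\pi_1(X,x_0)$. Then the following are equivalent: (1) $N$ is $(C,c_\infty)$-closed, (2) $N$ is $(C,c_\tau)$-closed, (3) $N$ is $(P,p_\tau)$-closed.
   Context: A map is a continuous function; $f_{\#}$ denotes the homomorphism induced on fundamental groups. For paths, $\alpha\cdot\beta$ is concatenation and $\alpha^{-}(t)=\alpha(1-t)$. Closed subgroups: for a based space $(\mathbb{T},t_0)$, a subgroup $T\leq\pi_1(\mathbb{T},t_0)$ and $g\in\pi_1(\mathbb{T},t_0)$, a subgroup $H\leq\pi_1(X,x_0)$ is $(T,g)$-closed if for every map $f:(\mathbb{T},t_0)\to(X,x_0)$ with $f_{\#}(T)\leq H$ we have $f_{\#}(g)\in H$. The test space $\mathbb{H}^+$: let $C_n\subseteq\mathbb{R}^2$ be the circle of radius $\frac1n$ centered at $(\frac1n,0)$, $\mathbb{H}=\bigcup_{n\geq1}C_n$, $b_0=(0,0)$, and $\mathbb{H}^+=\mathbb{H}\cup([-1,0]\times\{0\})$ with basepoint $b_0^+=(-1,0)$. Let $\ell_n$ be the loop based at $b_0$ traversing $C_n$ once counterclockwise, and $\ell_\infty:[0,1]\to\mathbb{H}$ the loop that is $\ell_n$ (linearly reparametrized) on $[\frac{n-1}{n},\frac{n}{n+1}]$ for each $n\geq1$, with $\ell_\infty(1)=b_0$. Let $\mathcal{C}\subseteq[0,1]$ be the standard middle third Cantor set and write $[0,1]\setminus\mathcal{C}=\bigcup_{n\geq1}\bigcup_{k=1}^{2^{n-1}}I_n^k$,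 where $I_n^k$ are the components of length $\frac{1}{3^n}$, indexed by $k$ in their natural order. Let $\ell_\tau:[0,1]\to\mathbb{H}$ be the loop with $\ell_\tau(\mathcal{C})=\{b_0\}$ and equal to $\ell_{2^{n-1}+k-1}$ (linearly reparametrized) on $\overline{I_n^k}$. Let $\iota:[0,1]\to\mathbb{H}^+$, $\iota(t)=(t-1,0)$. Put $c_n=[\iota\cdot\ell_n\cdot\iota^{-}]$, $C=\langle c_n\mid n\in\mathbb{N}\rangle\leq\pi_1(\mathbb{H}^+,b_0^+)$, $c_\infty=[\iota\cdot\ell_\infty\cdot\iota^{-}]$, and $c_\tau=[\iota\cdot\ell_\tau\cdot\iota^{-}]$. Let $f_{odd},f_{even}:\mathbb{H}\to\mathbb{H}$ be the maps with $f_{odd}\circ\ell_n=\ell_{2n-1}$ and $f_{even}\circ\ell_n=\ell_{2n}$. Put $p_n=[\iota\cdot\ell_{2n-1}\cdot\ell_{2n}^{-}\cdot\iota^{-}]$, $P=\langle p_n\mid n\in\mathbb{N}\rangle\leq\pi_1(\mathbb{H}^+,b_0^+)$, and $p_\tau=[\iota\cdot(f_{odd}\circ\ell_\tau)\cdot(f_{even}\circ\ell_\tau)^{-}\cdot\iota^{-}]$. *)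

theory Defs
  imports "HOL-Analysis.Analysis" "HOL-Algebra.Generated_Groups"
begin

section \<open>The fundamental group\<close>

text \<open>
  Spaces are subsets of a type of class \<^class>\<open>topological_space\<close> with the subspace topology.
  A path is a function on all of \<^typ>\<open>real\<close> of which only the values on \<open>[0,1]\<close> matter;
  functions that agree on \<open>[0,1]\<close> lie in the same homotopy class.
\<close>

definition loops_at :: "'a::topological_space set \<Rightarrow> 'a \<Rightarrow> (real \<Rightarrow> 'a) set" where
  "loops_at X x0 = {p. path p \<and> path_image p \<subseteq> X \<and> pathstart p = x0 \<and> pathfinish p = x0}"

definition hclass :: "'a::topological_space set \<Rightarrow> (real \<Rightarrow> 'a) \<Rightarrow> (real \<Rightarrow> 'a) set" where
  "hclass X p = {q. homotopic_paths X p q}"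

definition pi1 :: "'a::topological_space set \<Rightarrow> 'a \<Rightarrow> (real \<Rightarrow> 'a) set monoid" where
  "pi1 X x0 =
     \<lparr>carrier = hclass X ` loops_at X x0,
      mult = (\<lambda>A B. \<Union>p\<in>A. \<Union>q\<in>B. hclass X (p +++ q)),
      one = hclass X (\<lambda>_. x0)\<rparr>"

definition induced :: "'b::topological_space set \<Rightarrow> ('a::topological_space \<Rightarrow> 'b) \<Rightarrow>
    (real \<Rightarrow> 'a) set \<Rightarrow> (real \<Rightarrow> 'b) set" where
  "induced X f A = (\<Union>p\<in>A. hclass X (f \<circ> p))"

text \<open>\<open>tg_closed S s0 T g X x0 H\<close>: the subgroup \<open>H\<close> of \<open>pi1 X x0\<close> is \<open>(T,g)\<close>-closed, where
  \<open>(S,s0)\<close> is the test space, \<open>T\<close> a subgroup of \<open>pi1 S s0\<close> and \<open>g\<close> an element of \<open>pi1 S s0\<close>.\<close>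

definition tg_closed :: "'t::topological_space set \<Rightarrow> 't \<Rightarrow> (real \<Rightarrow> 't) set set \<Rightarrow> (real \<Rightarrow> 't) set \<Rightarrow>
    'a::topological_space set \<Rightarrow> 'a \<Rightarrow> (real \<Rightarrow> 'a) set set \<Rightarrow> bool" where
  "tg_closed S s0 T g X x0 H \<longleftrightarrow>
     (\<forall>f. continuous_on S f \<and> f \<in> S \<rightarrow> X \<and> f s0 = x0 \<and> induced X f ` T \<subseteq> H
        \<longrightarrow> induced X f g \<in> H)"


subsection \<open>The fundamental group is a group\<close>

lemma pi1_simps:
  "carrier (pi1 X x0) = hclass X ` loops_at X x0"
  "\<one>\<^bsub>pi1 X x0\<^esub> = hclass X (\<lambda>_. x0)"
  by (auto simp: pi1_def)

lemma hclass_eq_iff: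
  assumes "path p" "path_image p \<subseteq> X"
  shows "hclass X p = hclass X q \<longleftrightarrow> homotopic_paths X p q"
proof
  assume "hclass X p = hclass X q"
  moreover have "p \<in> hclass X p" using assms by (simp add: hclass_def)
  ultimately show "homotopic_paths X p q" by (simp add: hclass_def homotopic_paths_sym)
next
  assume pq: "homotopic_paths X p q"
  have "homotopic_paths X p r \<longleftrightarrow> homotopic_paths X q r" for r
    using homotopic_paths_trans[OF pq, of r] homotopic_paths_trans[OF homotopic_paths_sym[OF pq], of r]
    by blast
  thus "hclass X p = hclass X q"
    by (simp add: hclass_def)
qed

lemma loops_at_join: "p \<in> loops_at X x0 \<Longrightarrow> q \<in> loops_at X x0 \<Longrightarrow> p +++ q \<in> loops_at X x0"
  by (auto simp: loops_at_def path_image_join)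

lemma loops_at_const: "x0 \<in> X \<Longrightarrow> (\<lambda>_. x0) \<in> loops_at X x0"
  by (auto simp: loops_at_def path_def path_image_def pathstart_def pathfinish_def)

lemma loops_at_reverse: "p \<in> loops_at X x0 \<Longrightarrow> reversepath p \<in> loops_at X x0"
  by (auto simp: loops_at_def)

lemma hclass_subset_loops_at:
  assumes "p \<in> loops_at X x0" "q \<in> hclass X p"
  shows "q \<in> loops_at X x0"
  using assms homotopic_paths_imp_path[of X p q] homotopic_paths_imp_subset[of X p q]
    homotopic_paths_imp_pathstart[of X p q] homotopic_paths_imp_pathfinish[of X p q]
  by (auto simp: loops_at_def hclass_def)

lemma pi1_mult:
  assumes p: "p \<in> loops_at X x0" and q: "q \<in> loops_at X x0"
  shows "hclass X p \<otimes>\<^bsub>pi1 X x0\<^esub> hclass X q = hclass X (p +++ q)"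
proof -
  have "hclass X (p' +++ q') = hclass X (p +++ q)"
    if "p' \<in> hclass X p" "q' \<in> hclass X q" for p' q'
  proof -
    have "homotopic_paths X (p +++ q) (p' +++ q')"
      using that p q by (intro homotopic_paths_join) (auto simp: hclass_def loops_at_def)
    thus ?thesis
      by (metis hclass_eq_iff homotopic_paths_imp_path homotopic_paths_imp_subset)
  qed
  moreover have "p \<in> hclass X p" "q \<in> hclass X q"
    using p q by (auto simp: hclass_def loops_at_def)
  ultimately have "(\<Union>p'\<in>hclass X p. \<Union>q'\<in>hclass X q. hclass X (p' +++ q')) = hclass X (p +++ q)"
    by blast
  thus ?thesis
    by (simp add: pi1_def)
qed

lemma homotopic_paths_const_left:
  fixes p :: "real \<Rightarrow> 'a::topological_space"
  assumes "p \<in> loops_at X x0"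
  shows "homotopic_paths X ((\<lambda>_. x0) +++ p) p"
proof -
  have c: "continuous_on {0..1} (\<lambda>t::real. max 0 (2 * t - 1))"
    by (intro continuous_intros)
  have "homotopic_paths X p ((\<lambda>_. x0) +++ p)"
  proof (rule homotopic_paths_reparametrize[OF _ _ c])
    fix t :: real assume "t \<in> {0..1}"
    show "((\<lambda>_. x0) +++ p) t = p (max 0 (2 * t - 1))"
      using assms by (cases "t \<le> 1/2") (auto simp: loops_at_def joinpaths_def pathstart_def max_absorb1 max_absorb2)
  qed (use assms in \<open>auto simp: loops_at_def\<close>)
  thus ?thesis by (rule homotopic_paths_sym)
qed

lemma homotopic_paths_reverse_left:
  fixes p :: "real \<Rightarrow> 'a::topological_space"
  assumes p: "p \<in> loops_at X x0"
  shows "homotopic_paths X (reversepath p +++ p) (\<lambda>_. x0)"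
proof -
  have cp: "continuous_on {0..1} p" and im: "p ` {0..1} \<subseteq> X" and e: "p 0 = x0" "p 1 = x0"
    using p by (auto simp: loops_at_def path_def path_image_def pathstart_def pathfinish_def)
  define s where "s = (\<lambda>z::real\<times>real. \<bar>2 * snd z - 1\<bar> + fst z * (1 - \<bar>2 * snd z - 1\<bar>))"
  have s01: "s z \<in> {0..1}" if "z \<in> {0..1} \<times> {0..1}" for z
  proof -
    define a where "a = \<bar>2 * snd z - 1\<bar>"
    have a: "0 \<le> a" "a \<le> 1" and f: "0 \<le> fst z" "fst z \<le> 1"
      using that by (auto simp: a_def abs_if)
    have "0 \<le> fst z * (1 - a)" "fst z * (1 - a) \<le> 1 - a"
      using a f by (auto intro: mult_left_le_one_le)
    thus ?thesis using a by (auto simp: s_def a_def)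
  qed
  have "continuous_on ({0..1} \<times> {0..1}) (p \<circ> s)"
  proof (rule continuous_on_compose)
    show "continuous_on ({0..1} \<times> {0..1}) s"
      unfolding s_def by (intro continuous_intros)
    show "continuous_on (s ` ({0..1} \<times> {0..1})) p"
      by (rule continuous_on_subset[OF cp]) (use s01 in blast)
  qed
  moreover have "p \<circ> s \<in> ({0..1} \<times> {0..1}) \<rightarrow> X"
    using s01 im by (auto simp: image_subset_iff)
  moreover have "(p \<circ> s) (0, t) = (reversepath p +++ p) t" for t
    by (cases "t \<le> 1/2") (simp_all add: s_def joinpaths_def reversepath_def)
  moreover have "(p \<circ> s) (1, t) = x0" for t
    by (simp add: s_def e)
  moreover have "(p \<circ> s) (u, 0) = x0" "(p \<circ> s) (u, 1) = x0" for u
    by (simp_all add: s_def e)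
  ultimately show ?thesis
    unfolding homotopic_paths
    by (intro exI[of _ "p \<circ> s"])
       (simp add: e joinpaths_def reversepath_def pathstart_def pathfinish_def del: comp_apply, simp)
qed

lemma group_pi1:
  assumes "x0 \<in> X"
  shows "group (pi1 X x0)"
proof (rule groupI)
  fix a b assume "a \<in> carrier (pi1 X x0)" "b \<in> carrier (pi1 X x0)"
  thus "a \<otimes>\<^bsub>pi1 X x0\<^esub> b \<in> carrier (pi1 X x0)"
    by (auto simp: pi1_simps pi1_mult loops_at_join)
next
  show "\<one>\<^bsub>pi1 X x0\<^esub> \<in> carrier (pi1 X x0)"
    using loops_at_const[OF assms] by (auto simp: pi1_simps)
next
  fix a b c
  assume "a \<in> carrier (pi1 X x0)" "b \<in> carrier (pi1 X x0)" "c \<in> carrier (pi1 X x0)"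
  then obtain p q r where a: "a = hclass X p" "b = hclass X q" "c = hclass X r"
    and l: "p \<in> loops_at X x0" "q \<in> loops_at X x0" "r \<in> loops_at X x0"
    by (auto simp: pi1_simps)
  have "homotopic_paths X (p +++ q +++ r) ((p +++ q) +++ r)"
    using l by (intro homotopic_paths_assoc) (auto simp: loops_at_def)
  hence "hclass X (p +++ q +++ r) = hclass X ((p +++ q) +++ r)"
    by (metis hclass_eq_iff homotopic_paths_imp_path homotopic_paths_imp_subset)
  thus "a \<otimes>\<^bsub>pi1 X x0\<^esub> b \<otimes>\<^bsub>pi1 X x0\<^esub> c = a \<otimes>\<^bsub>pi1 X x0\<^esub> (b \<otimes>\<^bsub>pi1 X x0\<^esub> c)"
    by (simp add: a l pi1_mult loops_at_join)
next
  fix a assume "a \<in> carrier (pi1 X x0)"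
  then obtain p where a: "a = hclass X p" and l: "p \<in> loops_at X x0"
    by (auto simp: pi1_simps)
  note c = loops_at_const[OF assms]
  have eq: "hclass X q = hclass X r" if "homotopic_paths X q r" for q r
    using that by (metis hclass_eq_iff homotopic_paths_imp_path homotopic_paths_imp_subset)
  show "\<one>\<^bsub>pi1 X x0\<^esub> \<otimes>\<^bsub>pi1 X x0\<^esub> a = a"
    using eq[OF homotopic_paths_const_left[OF l]] by (simp add: a pi1_simps pi1_mult c l)
  have "hclass X (reversepath p) \<otimes>\<^bsub>pi1 X x0\<^esub> a = \<one>\<^bsub>pi1 X x0\<^esub>"
    using eq[OF homotopic_paths_reverse_left[OF l]]
    by (simp add: a pi1_simps pi1_mult l loops_at_reverse)
  moreover have "hclass X (reversepath p) \<in> carrier (pi1 X x0)"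
    using l by (simp add: pi1_simps loops_at_reverse)
  ultimately show "\<exists>b\<in>carrier (pi1 X x0). b \<otimes>\<^bsub>pi1 X x0\<^esub> a = \<one>\<^bsub>pi1 X x0\<^esub>"
    by blast
qed


section \<open>The test space\<close>

definition hcircle :: "nat \<Rightarrow> (real \<times> real) set" where
  "hcircle n = sphere (1 / real n, 0) (1 / real n)"

definition earring :: "(real \<times> real) set" where
  "earring = (\<Union>n\<in>{1..}. hcircle n)"

definition b0 :: "real \<times> real" where
  "b0 = (0, 0)"

definition earring_plus :: "(real \<times> real) set" where
  "earring_plus = earring \<union> {-1..0} \<times> {0}"

definition b0_plus :: "real \<times> real" where
  "b0_plus = (-1, 0)"

definition whisker :: "real \<Rightarrow> real \<times> real" where
  "whisker t = (t - 1, 0)"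

text \<open>The angle starts at \<open>\<pi>\<close> since \<open>b0\<close> is the leftmost point of every circle.\<close>

definition ell :: "nat \<Rightarrow> real \<Rightarrow> real \<times> real" where
  "ell n t = (1 / real n + 1 / real n * cos (pi + 2 * pi * t), 1 / real n * sin (pi + 2 * pi * t))"

text \<open>The path \<open>p\<close>, linearly reparametrized to run over the interval \<open>[a,b]\<close>.\<close>

definition on_interval :: "(real \<Rightarrow> 'a) \<Rightarrow> real \<Rightarrow> real \<Rightarrow> real \<Rightarrow> 'a" where
  "on_interval p a b t = p ((t - a) / (b - a))"

text \<open>Consecutive intervals share an endpoint, where both loops take the value \<open>b0\<close>; hence the
  description in the following definition is unique for every \<open>t\<close> in \<open>[0,1)\<close>.\<close>

definition ell_inf :: "real \<Rightarrow> real \<times> real" where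
  "ell_inf t =
     (if t = 1 then b0
      else THE w. \<exists>n\<ge>1. t \<in> {(real n - 1) / real n .. real n / (real n + 1)} \<and>
             w = on_interval (ell n) ((real n - 1) / real n) (real n / (real n + 1)) t)"


subsection \<open>The Cantor set and its complementary intervals\<close>

primrec cantor_stage :: "nat \<Rightarrow> real set" where
  "cantor_stage 0 = {0..1}"
| "cantor_stage (Suc n) = (\<lambda>x. x / 3) ` cantor_stage n \<union> (\<lambda>x. (x + 2) / 3) ` cantor_stage n"

definition cantor_set :: "real set" where
  "cantor_set = (\<Inter>n. cantor_stage n)"

definition cantor_gaps :: "nat \<Rightarrow> real set set" where
  "cantor_gaps n = {J \<in> components ({0..1} - cantor_set). diameter J = 1 / 3 ^ n}"

text \<open>The \<open>k\<close>-th component of length \<open>1 / 3 ^ n\<close>, counted from the left starting with \<open>k = 1\<close>.\<close>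

definition cantor_gap :: "nat \<Rightarrow> nat \<Rightarrow> real set" where
  "cantor_gap n k =
     (THE J. J \<in> cantor_gaps n \<and> card {J' \<in> cantor_gaps n. Inf J' \<le> Inf J} = k)"

definition ell_tau :: "real \<Rightarrow> real \<times> real" where
  "ell_tau t =
     (if t \<in> cantor_set then b0
      else THE w. \<exists>n\<ge>1. \<exists>k\<in>{1..2 ^ (n - 1)}. t \<in> closure (cantor_gap n k) \<and>
             w = on_interval (ell (2 ^ (n - 1) + k - 1)) (Inf (cantor_gap n k)) (Sup (cantor_gap n k)) t)"


subsection \<open>The test subgroups and test elements\<close>

text \<open>On \<open>earring\<close>, \<open>ell_map \<phi>\<close> is the map \<open>f\<close> with \<open>f \<circ> ell n = ell (\<phi> n)\<close> on \<open>[0,1]\<close> for all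
  \<open>n \<ge> 1\<close>.  The loops \<open>ell n\<close> meet only in \<open>b0\<close>, which is sent to \<open>b0\<close>.\<close>

definition ell_map :: "(nat \<Rightarrow> nat) \<Rightarrow> real \<times> real \<Rightarrow> real \<times> real" where
  "ell_map \<phi> z = (THE w. \<exists>n\<ge>1. \<exists>t\<in>{0..1}. z = ell n t \<and> w = ell (\<phi> n) t)"

definition f_odd :: "real \<times> real \<Rightarrow> real \<times> real" where
  "f_odd = ell_map (\<lambda>n. 2 * n - 1)"

definition f_even :: "real \<times> real \<Rightarrow> real \<times> real" where
  "f_even = ell_map (\<lambda>n. 2 * n)"

definition c_elt :: "nat \<Rightarrow> (real \<Rightarrow> real \<times> real) set" where
  "c_elt n = hclass earring_plus (whisker +++ ell n +++ reversepath whisker)"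

definition c_subgroup :: "(real \<Rightarrow> real \<times> real) set set" where
  "c_subgroup = generate (pi1 earring_plus b0_plus) (c_elt ` {1..})"

definition c_inf :: "(real \<Rightarrow> real \<times> real) set" where
  "c_inf = hclass earring_plus (whisker +++ ell_inf +++ reversepath whisker)"

definition c_tau :: "(real \<Rightarrow> real \<times> real) set" where
  "c_tau = hclass earring_plus (whisker +++ ell_tau +++ reversepath whisker)"

definition p_elt :: "nat \<Rightarrow> (real \<Rightarrow> real \<times> real) set" where
  "p_elt n = hclass earring_plus
     (whisker +++ ell (2 * n - 1) +++ reversepath (ell (2 * n)) +++ reversepath whisker)"

definition p_subgroup :: "(real \<Rightarrow> real \<times> real) set set" where
  "p_subgroup = generate (pi1 earring_plus b0_plus) (p_elt ` {1..})"

definition p_tau :: "(real \<Rightarrow> real \<times> real) set" where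
  "p_tau = hclass earring_plus
     (whisker +++ (f_odd \<circ> ell_tau) +++ reversepath (f_even \<circ> ell_tau) +++ reversepath whisker)"

end

theory Submission
  imports Defs
begin

text \<open>
  A map from the test space to \<open>X\<close> amounts to a path \<open>\<alpha>\<close> from \<open>x0\<close> to a point \<open>x1\<close> together with a sequence
  of loops at \<open>x1\<close> that is null: every neighbourhood of \<open>x1\<close> contains all but finitely many of them. Under
  this correspondence \<open>ell_inf\<close> and \<open>ell_tau\<close> become two infinite products of the loops, one in sequential
  order and one in the order of the gaps of the Cantor set. Each of the three closedness conditions
  thus says that if the loops (or the quotients of the pairs of loops) lie in \<open>N\<close> after conjugation with
  \<open>\<alpha>\<close>, then so does an infinite product (\<open>tg_closed_c_inf_iff\<close>, \<open>tg_closed_c_tau_iff\<close>, \<open>tg_closed_p_tau_iff\<close>).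
  
  Two implications are a matter of choosing families. Closedness for pairs gives closedness for the
  Cantor product by making the second loop of each pair constant. Closedness for the Cantor product
  gives closedness for the sequential product by placing the loops in the rightmost gaps of the
  successive levels and constant loops elsewhere, since up to homotopy an infinite product depends
  only on the order of its factors (\<open>homotopic_iprod\<close>).
  
  The implication from the sequential product to pairs in Cantor order uses that the quotient by \<open>N\<close> is
  abelian. Index the gaps by binary words and write \<open>T e\<close> for the product of a family \<open>e\<close> in Cantor order.
  By self-similarity \<open>T e\<close> is the product of \<open>T\<close> on the left half of the family, the loop at the empty
  word, and \<open>T\<close> on the right half (\<open>iprod_cantor_split\<close>). Hence, modulo \<open>N\<close>, the factors of the first \<open>n\<close>
  levels can be collected, and what remains is a product \<open>P n e\<close> that involves only loops of level \<open>n\<close> and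
  above (\<open>q_level_cantor\<close>). If the members of two families \<open>e\<close> and \<open>d\<close> agree modulo \<open>N\<close>, then all loops
  \<open>E n = P n e +++ reversepath (P n d)\<close> agree modulo \<open>N\<close>, although they become arbitrarily small. So the loops
  \<open>E n +++ reversepath (E (Suc n))\<close> form a null sequence in \<open>N\<close>, and by closedness their sequential product
  lies in \<open>N\<close>. But this product telescopes (\<open>telescoping_homotopy\<close>): it is homotopic to \<open>E 0\<close>, which is
  the product of \<open>T e\<close> with the inverse of \<open>T d\<close>.
\<close>

section \<open>Gluing null families of functions\<close>

text \<open>
  For functions with disjoint supports relative to \<open>x\<close>, this is their union. Infinite concatenations of
  loops and homotopies between them are all of this form: there is one function per factor, with value
  \<open>x\<close> outside of the interval (or strip) that belongs to the factor.
\<close>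
definition glue :: "'b \<Rightarrow> ('i \<Rightarrow> 'z \<Rightarrow> 'b) \<Rightarrow> 'z \<Rightarrow> 'b" where
  "glue x g z = (if \<exists>i. g i z \<noteq> x then g (SOME i. g i z \<noteq> x) z else x)"

lemma glue_eq_base: "(\<And>i. g i z = x) \<Longrightarrow> glue x g z = x"
  by (simp add: glue_def)

lemma glue_eqI:
  assumes "\<And>j. j \<noteq> i \<Longrightarrow> g j z = x"
  shows "glue x g z = g i z"
proof (cases "g i z = x")
  case True
  then show ?thesis using assms by (metis glue_eq_base)
next
  case False
  then have "(SOME i. g i z \<noteq> x) = i" using assms by (metis (mono_tags, lifting) someI_ex)
  then show ?thesis using False by (auto simp: glue_def)
qed

lemma glue_cases:
  assumes "\<forall>i j. i \<noteq> j \<longrightarrow> g i z = x \<or> g j z = x"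
  obtains (base) "\<And>i. g i z = x" "glue x g z = x"
    | (piece) i where "g i z \<noteq> x" "glue x g z = g i z"
proof (cases "\<exists>i. g i z \<noteq> x")
  case True
  then obtain i where i: "g i z \<noteq> x" by blast
  then have "glue x g z = g i z" using assms by (intro glue_eqI) metis
  then show ?thesis using piece i by blast
next
  case False
  then show ?thesis using base glue_eq_base by metis
qed

text \<open>
  The topological form of uniform convergence to the constant \<open>x\<close>.
\<close>
definition null_at :: "'b::topological_space \<Rightarrow> 'z set \<Rightarrow> ('i \<Rightarrow> 'z \<Rightarrow> 'b) \<Rightarrow> bool" where
  "null_at x Z g \<longleftrightarrow> (\<forall>U. open U \<and> x \<in> U \<longrightarrow> finite {i. \<not> g i ` Z \<subseteq> U})"

text \<open>
  At a point \<open>z\<close> at most one piece differs from \<open>x\<close>, so for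
  an open set \<open>V\<close> that misses \<open>x\<close> the preimage is the union of the preimages under the pieces, and for
  \<open>V\<close> containing \<open>x\<close> it is their intersection. Nullity makes this intersection finite in effect, as
  all but finitely many pieces map everything into \<open>V\<close>.
\<close>
lemma continuous_on_glue:
  fixes g :: "'i \<Rightarrow> 'z::topological_space \<Rightarrow> 'b::topological_space"
  assumes cont: "\<And>i. continuous_on Z (g i)"
    and disj: "\<And>i j z. z \<in> Z \<Longrightarrow> i \<noteq> j \<Longrightarrow> g i z = x \<or> g j z = x"
    and null: "null_at x Z g"
  shows "continuous_on Z (glue x g)"
proof -
  have glue_in: "glue x g z \<in> V \<longleftrightarrow> (if x \<in> V then \<forall>i. g i z \<in> V else \<exists>i. g i z \<in> V)"
    if "z \<in> Z" for z V
  proof -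
    have "\<forall>i j. i \<noteq> j \<longrightarrow> g i z = x \<or> g j z = x" using disj[OF that] by blast
    then show ?thesis
    proof (cases rule: glue_cases[where x = x and g = g and z = z])
      case base
      then show ?thesis by simp
    next
      case (piece i)
      then show ?thesis using disj[OF that] by metis
    qed
  qed
  have op: "\<exists>A. open A \<and> A \<inter> Z = g i -` V \<inter> Z" if "open V" for i V
    using cont[of i] that unfolding continuous_on_open_invariant by blast
  show ?thesis
    unfolding continuous_on_open_invariant
  proof (intro allI impI)
    fix V :: "'b set" assume V: "open V"
    obtain A where A: "\<And>i. open (A i)" "\<And>i. A i \<inter> Z = g i -` V \<inter> Z"
      using op[OF V] by metis
    then have A': "z \<in> A i \<longleftrightarrow> g i z \<in> V" if "z \<in> Z" for z i
      using that by blast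
    show "\<exists>B. open B \<and> B \<inter> Z = glue x g -` V \<inter> Z"
    proof (cases "x \<in> V")
      case True
      define F where "F = {i. \<not> g i ` Z \<subseteq> V}"
      have "finite F" using null True V by (auto simp: null_at_def F_def)
      moreover have "(\<Inter>i\<in>F. A i) \<inter> Z = glue x g -` V \<inter> Z"
      proof (rule Set.set_eqI)
        fix z
        have "(\<forall>i\<in>F. z \<in> A i) \<longleftrightarrow> (\<forall>i. g i z \<in> V)" if "z \<in> Z"
          using that A' unfolding F_def by (metis (mono_tags, lifting) image_subset_iff mem_Collect_eq)
        then show "z \<in> (\<Inter>i\<in>F. A i) \<inter> Z \<longleftrightarrow> z \<in> glue x g -` V \<inter> Z"
          using True glue_in by auto
      qed
      ultimately show ?thesis using A(1) by (metis open_INT)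
    next
      case False
      have "(\<Union>i. A i) \<inter> Z = glue x g -` V \<inter> Z"
        using A' glue_in False by auto
      then show ?thesis using A(1) by (metis open_UN)
    qed
  qed
qed

section \<open>Infinite products of loops\<close>
definition null_loops :: "'a::topological_space set \<Rightarrow> 'a \<Rightarrow> ('i \<Rightarrow> real \<Rightarrow> 'a) \<Rightarrow> bool" where
  "null_loops X x e \<longleftrightarrow> (\<forall>i. e i \<in> loops_at X x) \<and> null_at x {0..1} e"

text \<open>
  A loop composed with this map runs through the loop on \<open>[a,b]\<close> and rests at the base point elsewhere.
\<close>
definition stretch :: "real \<Rightarrow> real \<Rightarrow> real \<Rightarrow> real" where
  "stretch a b t = max 0 (min 1 ((t - a) / (b - a)))"

text \<open>
  The intervals \<open>[a i, b i]\<close> are meant to be disjoint up to end points; their order on the line is the order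
  of the factors, which may be any countable order type.
\<close>
definition iprod :: "'a \<Rightarrow> ('i \<Rightarrow> real) \<Rightarrow> ('i \<Rightarrow> real) \<Rightarrow> ('i \<Rightarrow> real \<Rightarrow> 'a) \<Rightarrow> real \<Rightarrow> 'a" where
  "iprod x a b e = glue x (\<lambda>i t. e i (stretch (a i) (b i) t))"

lemma stretch_01: "stretch a b t \<in> {0..1}"
  by (simp add: stretch_def)

lemma stretch_left: "a < b \<Longrightarrow> t \<le> a \<Longrightarrow> stretch a b t = 0"
  by (simp add: stretch_def max_def min_def divide_simps)

lemma stretch_right: "a < b \<Longrightarrow> b \<le> t \<Longrightarrow> stretch a b t = 1"
  by (simp add: stretch_def max_def min_def divide_simps)

lemma stretch_mid: "a < b \<Longrightarrow> a \<le> t \<Longrightarrow> t \<le> b \<Longrightarrow> stretch a b t = (t - a) / (b - a)"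
  by (auto simp: stretch_def max_def min_def divide_simps)

lemma loops_at_ends:
  assumes "p \<in> loops_at X x" shows "p 0 = x" "p 1 = x"
  using assms by (auto simp: loops_at_def pathstart_def pathfinish_def)

lemma loops_at_in: "p \<in> loops_at X x \<Longrightarrow> t \<in> {0..1} \<Longrightarrow> p t \<in> X"
  by (auto simp: loops_at_def path_image_def)

lemma loops_at_base: "p \<in> loops_at X x \<Longrightarrow> x \<in> X"
  using loops_at_in[of p X x 0] loops_at_ends[of p X x] by simp

lemma loop_stretch_outside:
  assumes "p \<in> loops_at X x" "a < b" "t \<notin> {a<..<b}"
  shows "p (stretch a b t) = x"
  using assms stretch_left[of a b t] stretch_right[of a b t] loops_at_ends[OF assms(1)]
  by (cases "t \<le> a") auto

lemma null_loopsD: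
  assumes "null_loops X x e"
  shows "e i \<in> loops_at X x" "null_at x {0..1} e" "continuous_on {0..1} (e i)"
  using assms by (auto simp: null_loops_def loops_at_def path_def)

lemma null_at_subset:
  assumes "null_at x {0..1} e" "\<And>i z. z \<in> Z \<Longrightarrow> \<exists>t\<in>{0..1}. g i z = e i t"
  shows "null_at x Z g"
  unfolding null_at_def
proof (intro allI impI, elim conjE)
  fix U assume "open U" "x \<in> U"
  then have "finite {i. \<not> e i ` {0..1} \<subseteq> U}" using assms(1) by (auto simp: null_at_def)
  moreover have "{i. \<not> g i ` Z \<subseteq> U} \<subseteq> {i. \<not> e i ` {0..1} \<subseteq> U}"
    using assms(2) by fastforce
  ultimately show "finite {i. \<not> g i ` Z \<subseteq> U}" by (rule finite_subset[rotated])
qed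

text \<open>
  Up to homotopy only the order of the intervals matters. Interpolating linearly between the end
  points keeps the intervals disjoint at every time when both families are ordered in the same way,
  and then the moving product is glued from a null family on the square.
\<close>
lemma homotopic_iprod:
  fixes e :: "'i \<Rightarrow> real \<Rightarrow> 'a::topological_space"
  assumes e: "null_loops X x e" and x: "x \<in> X"
    and ab: "\<And>i. 0 \<le> a i" "\<And>i. a i < b i" "\<And>i. b i \<le> 1"
    and cd: "\<And>i. 0 \<le> c i" "\<And>i. c i < d i" "\<And>i. d i \<le> 1"
    and ord: "\<And>i j. i \<noteq> j \<Longrightarrow> b i \<le> a j \<and> d i \<le> c j \<or> b j \<le> a i \<and> d j \<le> c i"
  shows "homotopic_paths X (iprod x a b e) (iprod x c d e)"
proof -
  \<comment> \<open>The interval of the factor \<open>i\<close> at time \<open>s\<close>.\<close>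
  define A where "A = (\<lambda>i s::real. (1 - s) * a i + s * c i)"
  define B where "B = (\<lambda>i s::real. (1 - s) * b i + s * d i)"
  define g where "g = (\<lambda>i (z::real\<times>real). e i (stretch (A i (fst z)) (B i (fst z)) (snd z)))"
  let ?Z = "{0..1::real} \<times> {0..1::real}"
  have AB: "A i s < B i s" if "s \<in> {0..1}" for i s
  proof (cases "s = 1")
    case False
    then have "(1-s) * a i < (1-s) * b i" using ab that by simp
    moreover have "s * c i \<le> s * d i" using less_imp_le[OF cd(2)] that by (simp add: mult_left_mono)
    ultimately show ?thesis by (simp add: A_def B_def)
  qed (simp add: A_def B_def cd)
  have A0: "0 \<le> A i s" and B1: "B i s \<le> 1" if "s \<in> {0..1}" for i s
    using ab cd that by (auto simp: A_def B_def intro!: convex_bound_le)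
  have BA: "B i s \<le> A j s \<or> B j s \<le> A i s" if "i \<noteq> j" "s \<in> {0..1}" for i j s
  proof -
    have *: "B i s \<le> A j s" if "b i \<le> a j" "d i \<le> c j" for i j
      using that \<open>s \<in> _\<close> unfolding A_def B_def by (intro add_mono mult_left_mono) auto
    show ?thesis using ord[OF that(1)] * by blast
  qed
  have outside: "g i z = x" if "z \<in> ?Z" "snd z \<notin> {A i (fst z)<..<B i (fst z)}" for i z
    unfolding g_def using that AB null_loopsD(1)[OF e] by (intro loop_stretch_outside) auto
  have contg: "continuous_on ?Z (g i)" for i
    unfolding g_def
  proof (rule continuous_on_compose2[OF null_loopsD(3)[OF e, of i]])
    have "\<forall>z\<in>?Z. B i (fst z) - A i (fst z) \<noteq> 0" using AB[of _ i] by auto (metis less_irrefl)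
    then show "continuous_on ?Z (\<lambda>z. stretch (A i (fst z)) (B i (fst z)) (snd z))"
      unfolding stretch_def A_def B_def by (intro continuous_intros) auto
  qed (use stretch_01 in blast)
  have disj: "g i z = x \<or> g j z = x" if "z \<in> ?Z" "i \<noteq> j" for i j z
    using outside[OF that(1), of i] outside[OF that(1), of j] BA[OF that(2), of "fst z"] that(1) by fastforce
  have null: "null_at x ?Z g"
    by (rule null_at_subset[OF null_loopsD(2)[OF e]]) (use stretch_01 in \<open>auto simp: g_def\<close>)
  have "continuous_on ?Z (glue x g)"
    by (rule continuous_on_glue[OF contg disj null])
  moreover have "glue x g \<in> ?Z \<rightarrow> X"
  proof
    fix z :: "real \<times> real" assume "z \<in> ?Z"
    show "glue x g z \<in> X"
      by (rule glue_cases[where x = x and g = g and z = z], use disj[OF \<open>z \<in> ?Z\<close>] in blast)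
         (use x loops_at_in[OF null_loopsD(1)[OF e] stretch_01] in \<open>auto simp: g_def\<close>)
  qed
  moreover have "glue x g (0, t) = iprod x a b e t" "glue x g (1, t) = iprod x c d e t" for t
    by (simp_all add: iprod_def glue_def g_def A_def B_def)
  moreover have "glue x g (s, 0) = x" "glue x g (s, 1) = x" if "s \<in> {0..1}" for s
    by (rule glue_eq_base, rule outside, use that A0[OF that] B1[OF that] in \<open>auto simp: not_less\<close>)+
  moreover have "iprod x a b e 0 = x" "iprod x a b e 1 = x"
    using \<open>\<And>t. glue x g (0, t) = iprod x a b e t\<close> calculation(5,6)[of 0] by auto
  ultimately show ?thesis
    unfolding homotopic_paths
    by (intro exI[of _ "glue x g"]) (auto simp: pathstart_def pathfinish_def)
qed

lemma iprod_loop: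
  assumes e: "null_loops X x e" and x: "x \<in> X"
    and ab: "\<And>i. 0 \<le> a i" "\<And>i. a i < b i" "\<And>i. b i \<le> 1"
    and ord: "\<And>i j. i \<noteq> j \<Longrightarrow> b i \<le> a j \<or> b j \<le> a i"
  shows "iprod x a b e \<in> loops_at X x"
proof -
  have h: "homotopic_paths X (iprod x a b e) (iprod x a b e)"
    by (rule homotopic_iprod[OF e x ab ab]) (use ord in blast)
  have "iprod x a b e 0 = x" "iprod x a b e 1 = x"
    unfolding iprod_def
    by (rule glue_eq_base, rule loop_stretch_outside[OF null_loopsD(1)[OF e] ab(2)],
        use ab(1,3) in \<open>simp add: not_less\<close>)+
  then show ?thesis using h
    by (auto simp: loops_at_def pathstart_def pathfinish_def)
qed

lemma iprod_eq:
  assumes e: "\<And>j. e j \<in> loops_at X x"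
    and ab: "\<And>i. a i < b i"
    and ord: "\<And>j. i \<noteq> j \<Longrightarrow> b i \<le> a j \<or> b j \<le> a i"
    and t: "t \<in> {a i..b i}"
  shows "iprod x a b e t = e i ((t - a i) / (b i - a i))"
proof -
  have "e j (stretch (a j) (b j) t) = x" if "j \<noteq> i" for j
    using ord[of j] that t by (intro loop_stretch_outside[OF e ab]) auto
  then have "iprod x a b e t = e i (stretch (a i) (b i) t)"
    unfolding iprod_def by (intro glue_eqI)
  then show ?thesis using t ab by (simp add: stretch_mid)
qed

lemma iprod_base:
  assumes e: "\<And>j. e j \<in> loops_at X x"
    and ab: "\<And>i. a i < b i"
    and t: "\<And>i. t \<notin> {a i<..<b i}"
  shows "iprod x a b e t = x"
  unfolding iprod_def by (intro glue_eq_base loop_stretch_outside[OF e ab t])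

lemma iprod_image:
  assumes "\<And>i t. t \<in> {0..1} \<Longrightarrow> e i t \<in> U" "x \<in> U"
  shows "iprod x a b e t \<in> U"
  using assms stretch_01 by (simp add: iprod_def glue_def)

text \<open>
  Disjointness of the intervals leaves at most one factor to be considered at each \<open>t\<close>, so the
  identity is checked one factor at a time.
\<close>
lemma iprod_compose:
  assumes e: "\<And>j. e j \<in> loops_at X x"
    and ab: "\<And>i. a i < b i"
    and ord: "\<And>i j. i \<noteq> j \<Longrightarrow> b i \<le> a j \<or> b j \<le> a i"
    and fe: "\<And>j t. t \<in> {0..1} \<Longrightarrow> f (e j t) = e' j t" and fx: "f x = x'"
  shows "f (iprod x a b e t) = iprod x' a b e' t"
proof -
  let ?g = "\<lambda>i t. e i (stretch (a i) (b i) t)"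
  have disj: "?g i t = x \<or> ?g j t = x" if "i \<noteq> j" for i j
    using ord[OF that] loop_stretch_outside[OF e ab, of t i] loop_stretch_outside[OF e ab, of t j]
    by force
  then have disj2: "\<forall>i j. i \<noteq> j \<longrightarrow> ?g i t = x \<or> ?g j t = x" by blast
  have e': "e' i (stretch (a i) (b i) t) = f (?g i t)" for i
    by (rule fe[symmetric]) (rule stretch_01)
  show ?thesis
    using disj2
  proof (cases rule: glue_cases[where x = x and g = ?g and z = t])
    case base
    then show ?thesis using e' fx by (simp add: iprod_def glue_eq_base)
  next
    case (piece i)
    then have "iprod x' a b e' t = e' i (stretch (a i) (b i) t)"
      unfolding iprod_def using disj[of i] fx e' by (intro glue_eqI) auto
    then show ?thesis using piece e' by (simp add: iprod_def)
  qed
qed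

section \<open>The fundamental group and change of base point\<close>

text \<open>
  In an arbitrary space the unit law is a reparametrization, and the inverse law below is the image
  under the path of the inverse law for the identity path of \<open>[0,1]\<close>.
\<close>
lemma homotopic_lid:
  fixes p :: "real \<Rightarrow> 'a::topological_space"
  assumes "path p" "path_image p \<subseteq> X" "pathstart p = x"
  shows "homotopic_paths X ((\<lambda>_. x) +++ p) p"
proof -
  have "homotopic_paths X p ((\<lambda>_. x) +++ p)"
  proof (rule homotopic_paths_reparametrize[where f = "\<lambda>t. max 0 (2 * t - 1)"])
    show "((\<lambda>_. x) +++ p) t = p (max 0 (2 * t - 1))" if "t \<in> {0..1}" for t
      using assms by (cases "2 * t = 1") (auto simp: joinpaths_def pathstart_def max_def)
    show "continuous_on {0..1} (\<lambda>t::real. max 0 (2 * t - 1))" by (intro continuous_intros)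
  qed (use assms in auto)
  then show ?thesis by (rule homotopic_paths_sym)
qed

lemma homotopic_linv:
  fixes p :: "real \<Rightarrow> 'a::topological_space"
  assumes "path p" "path_image p \<subseteq> X" "pathfinish p = x"
  shows "homotopic_paths X (reversepath p +++ p) (\<lambda>_. x)"
proof -
  define i where "i = (\<lambda>t::real. t)"
  have "homotopic_paths {0..1} (reversepath i +++ i) (linepath (pathfinish i) (pathfinish i))"
    by (rule homotopic_paths_linv) (auto simp: i_def path_def path_image_def)
  then have "homotopic_paths X (p \<circ> (reversepath i +++ i)) (p \<circ> linepath (pathfinish i) (pathfinish i))"
    by (rule homotopic_paths_continuous_image)
       (use assms in \<open>auto simp: path_def path_image_def\<close>)
  moreover have "p \<circ> (reversepath i +++ i) = reversepath p +++ p"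
    by (auto simp: fun_eq_iff i_def joinpaths_def reversepath_def)
  moreover have "p \<circ> linepath (pathfinish i) (pathfinish i) = (\<lambda>_. x)"
    using assms by (auto simp: fun_eq_iff i_def pathfinish_def linepath_def)
  ultimately show ?thesis by simp
qed

lemma hclass_eqI: "homotopic_paths X p q \<Longrightarrow> hclass X p = hclass X q"
  by (metis hclass_eq_iff homotopic_paths_imp_path homotopic_paths_imp_subset)

lemma induced_hclass:
  assumes f: "continuous_on S f" "f \<in> S \<rightarrow> X" and p: "path p" "path_image p \<subseteq> S"
  shows "induced X f (hclass S p) = hclass X (f \<circ> p)"
proof -
  have "hclass X (f \<circ> q) = hclass X (f \<circ> p)" if "q \<in> hclass S p" for q
    using that homotopic_paths_sym[OF homotopic_paths_continuous_image[OF _ f, of p q]]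
    by (intro hclass_eqI) (simp add: hclass_def)
  moreover have "p \<in> hclass S p" using p by (simp add: hclass_def)
  then have "hclass S p \<noteq> {}" by blast
  ultimately show ?thesis unfolding induced_def by (intro SUP_eq_const)
qed

lemma loops_at_compose:
  assumes f: "continuous_on S f" "f \<in> S \<rightarrow> X" and p: "p \<in> loops_at S s0"
  shows "f \<circ> p \<in> loops_at X (f s0)"
proof -
  have "path (f \<circ> p)"
    using p continuous_on_subset[OF f(1)] by (intro path_continuous_image) (auto simp: loops_at_def)
  then show ?thesis
    using p f by (auto simp: loops_at_def path_image_compose pathstart_compose pathfinish_compose)
qed

lemma induced_hom:
  assumes f: "continuous_on S f" "f \<in> S \<rightarrow> X" and s0: "s0 \<in> S"
  shows "induced X f \<in> hom (pi1 S s0) (pi1 X (f s0))"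
proof (rule homI)
  have ind: "induced X f (hclass S p) = hclass X (f \<circ> p)" if "p \<in> loops_at S s0" for p
    using that by (intro induced_hclass[OF f]) (auto simp: loops_at_def)
  note fl = loops_at_compose[OF f]
  fix A assume "A \<in> carrier (pi1 S s0)"
  then obtain p where p: "p \<in> loops_at S s0" "A = hclass S p" unfolding pi1_simps by (elim imageE)
  then show "induced X f A \<in> carrier (pi1 X (f s0))"
    unfolding pi1_simps using ind fl by simp
  fix B assume "B \<in> carrier (pi1 S s0)"
  then obtain q where q: "q \<in> loops_at S s0" "B = hclass S q" unfolding pi1_simps by (elim imageE)
  show "induced X f (A \<otimes>\<^bsub>pi1 S s0\<^esub> B) = induced X f A \<otimes>\<^bsub>pi1 X (f s0)\<^esub> induced X f B"
    unfolding p(2) q(2) pi1_mult[OF p(1) q(1)] ind[OF p(1)] ind[OF q(1)]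
      ind[OF loops_at_join[OF p(1) q(1)]] pi1_mult[OF fl[OF p(1)] fl[OF q(1)]] path_compose_join ..
qed

text \<open>
  In testing closedness it suffices to look at generators of the test subgroup.
\<close>
lemma induced_generate_subset_iff:
  assumes f: "continuous_on S f" "f \<in> S \<rightarrow> X" and s0: "s0 \<in> S"
    and A: "A \<subseteq> carrier (pi1 S s0)" and N: "subgroup N (pi1 X (f s0))"
  shows "induced X f ` generate (pi1 S s0) A \<subseteq> N \<longleftrightarrow> induced X f ` A \<subseteq> N"
proof -
  have "f s0 \<in> X" using f s0 by auto
  interpret h: group_hom "pi1 S s0" "pi1 X (f s0)" "induced X f"
    by (intro group_hom.intro group_pi1 s0 \<open>f s0 \<in> X\<close> group_hom_axioms.intro induced_hom[OF f])
  have "generate (pi1 X (f s0)) (induced X f ` A) = induced X f ` generate (pi1 S s0) A"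
    by (rule h.generate_img[OF A])
  moreover have "generate (pi1 X (f s0)) (induced X f ` A) \<subseteq> N \<longleftrightarrow> induced X f ` A \<subseteq> N"
    using h.H.generate_subgroup_incl[OF _ N] generate.incl[of _ "induced X f ` A" "pi1 X (f s0)"]
    by (meson subset_iff)
  ultimately show ?thesis by simp
qed

definition whiskered :: "'a::topological_space set \<Rightarrow> (real \<Rightarrow> 'a) \<Rightarrow> (real \<Rightarrow> 'a) \<Rightarrow> (real \<Rightarrow> 'a) set" where
  "whiskered X \<alpha> p = hclass X (\<alpha> +++ p +++ reversepath \<alpha>)"

text \<open>
  Conjugation by \<open>\<alpha>\<close> turns loops at \<open>x1\<close> into elements of the fundamental group at \<open>x0\<close>, compatibly with
  products and inverses.
\<close>
locale whisker_path =
  fixes X :: "'a::topological_space set" and x0 x1 :: 'a and \<alpha> :: "real \<Rightarrow> 'a"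
  assumes path: "path \<alpha>" and image: "path_image \<alpha> \<subseteq> X"
    and start: "pathstart \<alpha> = x0" and finish: "pathfinish \<alpha> = x1"
begin

lemma x0_in: "x0 \<in> X" and x1_in: "x1 \<in> X"
  using image start finish pathstart_in_path_image pathfinish_in_path_image by blast+

lemma whiskered_loop:
  assumes "p \<in> loops_at X x1"
  shows "\<alpha> +++ p +++ reversepath \<alpha> \<in> loops_at X x0"
  using assms path image start finish by (auto simp: loops_at_def path_image_join)

lemma whiskered_in_carrier: "p \<in> loops_at X x1 \<Longrightarrow> whiskered X \<alpha> p \<in> carrier (pi1 X x0)"
  using whiskered_loop by (auto simp: whiskered_def pi1_simps)

lemma whiskered_homotopic:
  assumes "homotopic_paths X p q" "p \<in> loops_at X x1"
  shows "whiskered X \<alpha> p = whiskered X \<alpha> q"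
  unfolding whiskered_def using assms path image start finish
  by (intro hclass_eqI homotopic_paths_join) (auto simp: loops_at_def)

lemma whiskered_const: "whiskered X \<alpha> (\<lambda>_. x1) = \<one>\<^bsub>pi1 X x0\<^esub>"
proof -
  have *: "homotopic_paths X ((\<lambda>_. x1) +++ reversepath \<alpha>) (reversepath \<alpha>)"
    using path image finish by (intro homotopic_lid) auto
  have "homotopic_paths X (\<alpha> +++ (\<lambda>_. x1) +++ reversepath \<alpha>) (\<alpha> +++ reversepath \<alpha>)"
    using path image finish by (intro homotopic_paths_join *) (auto simp: pathstart_def pathfinish_def joinpaths_def)
  also have "homotopic_paths X (\<alpha> +++ reversepath \<alpha>) (\<lambda>_. x0)"
    using homotopic_linv[of "reversepath \<alpha>" X x0] path image start by simp
  finally show ?thesis unfolding whiskered_def pi1_simps by (rule hclass_eqI)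
qed

lemma whiskered_join:
  assumes p: "p \<in> loops_at X x1" and q: "q \<in> loops_at X x1"
  shows "whiskered X \<alpha> (p +++ q) = whiskered X \<alpha> p \<otimes>\<^bsub>pi1 X x0\<^esub> whiskered X \<alpha> q"
proof -
  let ?r = "reversepath \<alpha>"
  note facts = path image start finish p[unfolded loops_at_def] q[unfolded loops_at_def]
  let ?Y = "q +++ ?r"
  have "homotopic_paths X (?r +++ \<alpha> +++ ?Y) ((?r +++ \<alpha>) +++ ?Y)"
    by (rule homotopic_paths_assoc) (use facts in \<open>auto simp: path_image_join\<close>)
  also have "homotopic_paths X ((?r +++ \<alpha>) +++ ?Y) ((\<lambda>_. x1) +++ ?Y)"
    by (intro homotopic_paths_join homotopic_linv) (use facts in \<open>auto simp: path_image_join\<close>)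
  also have "homotopic_paths X ((\<lambda>_. x1) +++ ?Y) ?Y"
    by (intro homotopic_lid) (use facts in \<open>auto simp: path_image_join\<close>)
  finally have cancel: "homotopic_paths X (?r +++ \<alpha> +++ ?Y) ?Y" .
  have "homotopic_paths X ((\<alpha> +++ p +++ ?r) +++ \<alpha> +++ ?Y) (\<alpha> +++ (p +++ ?r) +++ \<alpha> +++ ?Y)"
    by (rule homotopic_paths_sym, rule homotopic_paths_assoc)
       (use facts in \<open>auto simp: path_image_join\<close>)
  also have "homotopic_paths X (\<alpha> +++ (p +++ ?r) +++ \<alpha> +++ ?Y) (\<alpha> +++ p +++ ?r +++ \<alpha> +++ ?Y)"
    by (intro homotopic_paths_join homotopic_paths_sym[OF homotopic_paths_assoc])
       (use facts in \<open>auto simp: path_image_join\<close>)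
  also have "homotopic_paths X (\<alpha> +++ p +++ ?r +++ \<alpha> +++ ?Y) (\<alpha> +++ p +++ ?Y)"
    by (intro homotopic_paths_join cancel) (use facts in \<open>auto simp: path_image_join\<close>)
  also have "homotopic_paths X (\<alpha> +++ p +++ ?Y) (\<alpha> +++ (p +++ q) +++ ?r)"
    by (intro homotopic_paths_join homotopic_paths_assoc)
       (use facts in \<open>auto simp: path_image_join\<close>)
  finally show ?thesis
    unfolding whiskered_def pi1_mult[OF whiskered_loop[OF p] whiskered_loop[OF q]]
    by (rule hclass_eqI[symmetric])
qed

lemma whiskered_reverse:
  assumes p: "p \<in> loops_at X x1"
  shows "whiskered X \<alpha> (reversepath p) = inv\<^bsub>pi1 X x0\<^esub> whiskered X \<alpha> p"
proof -
  interpret group "pi1 X x0" by (rule group_pi1[OF x0_in])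
  have "whiskered X \<alpha> (reversepath p +++ p) = whiskered X \<alpha> (\<lambda>_. x1)"
    using p by (intro whiskered_homotopic loops_at_join loops_at_reverse homotopic_linv)
      (auto simp: loops_at_def)
  then show ?thesis
    using p by (intro inv_equality[symmetric])
      (simp_all add: whiskered_join whiskered_const loops_at_reverse whiskered_in_carrier)
qed

end

text \<open>
  A subgroup that contains all commutators is normal with abelian quotient. Stating this through a
  homomorphism with kernel \<open>N\<close> replaces all coset computations by calculations in \<open>K\<close>.
\<close>
lemma (in group) abelian_quotient:
  assumes N: "subgroup N G" and D: "derived G (carrier G) \<subseteq> N"
  obtains K :: "'a set monoid" and \<phi> where "comm_group K" "\<phi> \<in> hom G K"
    "\<And>g. g \<in> carrier G \<Longrightarrow> \<phi> g = \<one>\<^bsub>K\<^esub> \<longleftrightarrow> g \<in> N"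
proof -
  have comm: "a \<otimes> b \<otimes> inv a \<otimes> inv b \<in> N" if "a \<in> carrier G" "b \<in> carrier G" for a b
  proof -
    have "a \<otimes> b \<otimes> inv a \<otimes> inv b \<in> derived_set G (carrier G)" using that by blast
    from generate.incl[OF this] show ?thesis using D unfolding derived_def by (rule rev_subsetD)
  qed
  note Nc = subgroup.mem_carrier[OF N]
  have normal: "N \<lhd> G"
  proof (rule normal_invI[OF N])
    fix x h assume x: "x \<in> carrier G" and h: "h \<in> N"
    have "x \<otimes> h \<otimes> inv x \<otimes> inv h \<otimes> h \<in> N"
      by (rule subgroup.m_closed[OF N comm[OF x Nc[OF h]] h])
    then show "x \<otimes> h \<otimes> inv x \<in> N" using x Nc[OF h] by (simp add: m_assoc)
  qed
  interpret normal N G by (rule normal)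
  have "comm_group (G Mod N)"
  proof (rule group.group_comm_groupI[OF factorgroup_is_group])
    fix x y assume xy: "x \<in> carrier (G Mod N)" "y \<in> carrier (G Mod N)"
    obtain a where a: "a \<in> carrier G" "x = N #> a"
      using xy(1) unfolding carrier_FactGroup by (elim imageE)
    obtain b where b: "b \<in> carrier G" "y = N #> b"
      using xy(2) unfolding carrier_FactGroup by (elim imageE)
    note ab = a(1) b(1) a(2) b(2)
    have "a \<otimes> b \<otimes> inv a \<otimes> inv b \<otimes> (b \<otimes> a) = a \<otimes> b \<otimes> inv a \<otimes> (inv b \<otimes> (b \<otimes> a))"
      using ab(1,2) by (intro m_assoc) auto
    also have "inv b \<otimes> (b \<otimes> a) = inv b \<otimes> b \<otimes> a" using ab(1,2) by (intro m_assoc[symmetric]) auto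
    also have "a \<otimes> b \<otimes> inv a \<otimes> (inv b \<otimes> b \<otimes> a) = a \<otimes> b" using ab(1,2) by (simp add: m_assoc)
    finally have *: "a \<otimes> b \<otimes> inv a \<otimes> inv b \<otimes> (b \<otimes> a) = a \<otimes> b" .
    have "a \<otimes> b \<otimes> inv a \<otimes> inv b \<otimes> (b \<otimes> a) \<in> N #> (b \<otimes> a)"
      by (rule rcosI[OF comm[OF ab(1,2)] subset]) (use ab(1,2) in simp)
    then have "a \<otimes> b \<in> N #> (b \<otimes> a)" unfolding * .
    then have "N #> (b \<otimes> a) = N #> (a \<otimes> b)"
      using ab(1,2) by (intro repr_independence[OF _ _ N]) simp_all
    then show "x \<otimes>\<^bsub>G Mod N\<^esub> y = y \<otimes>\<^bsub>G Mod N\<^esub> x"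
      unfolding ab(3,4) mult_FactGroup rcos_sum[OF ab(1,2)] rcos_sum[OF ab(2,1)] by (rule sym)
  qed
  then show ?thesis
  proof (rule that)
    show "(#>) N \<in> hom G (G Mod N)" by (rule r_coset_hom_Mod)
    have "\<one>\<^bsub>G Mod N\<^esub> = N" by (simp add: FactGroup_def)
    then show "N #> g = \<one>\<^bsub>G Mod N\<^esub> \<longleftrightarrow> g \<in> N" if "g \<in> carrier G" for g
      using coset_join1[OF _ that N] coset_join2[OF that N] by argo
  qed
qed

section \<open>The gaps of the Cantor set\<close>

text \<open>
  The gaps are the nodes of a binary tree: the root is the middle third, and the gaps in the left and
  right thirds are the images of all gaps under the two contractions that generate the Cantor set. The
  first letter of a word thus tells the third in which the gap lies.
\<close>
primrec gap_lo :: "bool list \<Rightarrow> real" where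
  "gap_lo [] = 1/3"
| "gap_lo (x # L) = (gap_lo L + (if x then 2 else 0)) / 3"

definition gap_hi :: "bool list \<Rightarrow> real" where
  "gap_hi L = gap_lo L + 1 / 3 ^ Suc (length L)"

lemma gap_hi_simps [simp]:
  "gap_hi [] = 2/3" "gap_hi (x # L) = (gap_hi L + (if x then 2 else 0)) / 3"
  by (auto simp: gap_hi_def field_simps)

lemma gap_less: "gap_lo L < gap_hi L"
  by (simp add: gap_hi_def)

lemma gap_bounds: "0 < gap_lo L" "gap_hi L < 1"
  by (induction L) auto

text \<open>
  The separation is strict, so the end points of a gap lie in no gap and belong to the Cantor set.
\<close>
lemma gap_separated: "L \<noteq> M \<Longrightarrow> gap_hi L < gap_lo M \<or> gap_hi M < gap_lo L"
proof (induction L arbitrary: M)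
  case Nil
  then show ?case using gap_bounds by (cases M) auto
next
  case (Cons x L)
  show ?case
  proof (cases M)
    case Nil
    then show ?thesis using gap_bounds[of L] by auto
  next
    case (Cons y M')
    have "gap_lo L < 1" "0 < gap_hi L" "gap_lo M' < 1" "0 < gap_hi M'"
      using gap_bounds gap_less by (metis less_trans)+
    then show ?thesis
      using Cons Cons.IH[of M'] Cons.prems gap_bounds[of L] gap_bounds[of M'] by auto
  qed
qed

abbreviation gap :: "bool list \<Rightarrow> real set" where
  "gap L \<equiv> {gap_lo L<..<gap_hi L}"

lemma cantor_stage_subset: "cantor_stage n \<subseteq> {0..1}"
  by (induction n) auto

lemma not_cantor_stage_iff:
  "t \<in> {0..1} - cantor_stage n \<longleftrightarrow> (\<exists>L. length L < n \<and> t \<in> gap L)"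
proof (induction n arbitrary: t)
  case 0
  then show ?case by simp
next
  case (Suc n)
  have scale: "t \<in> (\<lambda>x. x / 3) ` S \<longleftrightarrow> 3 * t \<in> S" "t \<in> (\<lambda>x. (x + 2) / 3) ` S \<longleftrightarrow> 3 * t - 2 \<in> S"
    for S :: "real set"
  proof -
    have "t = x / 3 \<longleftrightarrow> x = 3 * t" "t = (x + 2) / 3 \<longleftrightarrow> x = 3 * t - 2" for x by auto
    then show "t \<in> (\<lambda>x. x / 3) ` S \<longleftrightarrow> 3 * t \<in> S" "t \<in> (\<lambda>x. (x + 2) / 3) ` S \<longleftrightarrow> 3 * t - 2 \<in> S"
      by (simp_all add: image_iff)
  qed
  have step: "(\<exists>L. length L < Suc n \<and> t \<in> gap L) \<longleftrightarrow>
      t \<in> gap [] \<or> (\<exists>L. length L < n \<and> 3 * t \<in> gap L) \<or> (\<exists>L. length L < n \<and> 3 * t - 2 \<in> gap L)"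
    (is "?l \<longleftrightarrow> ?r")
  proof
    assume ?l
    then obtain L where L: "length L < Suc n" "t \<in> gap L" by blast
    show ?r
    proof (cases L)
      case (Cons x M)
      then show ?thesis using L by (cases x) (auto simp: field_simps)
    qed (use L in auto)
  next
    assume ?r
    then consider "t \<in> gap []" | M where "length M < n" "3 * t \<in> gap M"
      | M where "length M < n" "3 * t - 2 \<in> gap M" by blast
    then show ?l
    proof cases
      case 1
      then show ?thesis by (intro exI[of _ "[]"]) simp
    next
      case 2
      then show ?thesis by (intro exI[of _ "False # M"]) (simp add: field_simps)
    next
      case 3
      then show ?thesis by (intro exI[of _ "True # M"]) (simp add: field_simps)
    qed
  qed
  have out: "s \<notin> gap L" if "s \<notin> {0..1}" for s L
    using that gap_bounds[of L] by auto
  have st: "s \<notin> cantor_stage n" if "s \<notin> {0..1}" for s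
    using that cantor_stage_subset by blast
  show ?case
    unfolding step cantor_stage.simps Diff_iff Un_iff scale Suc.IH[symmetric]
    using st[of "3 * t"] st[of "3 * t - 2"] by auto
qed

lemma not_cantor_set_iff: "t \<in> {0..1} - cantor_set \<longleftrightarrow> (\<exists>L. t \<in> gap L)"
proof -
  have "t \<in> {0..1} - cantor_set \<longleftrightarrow> (\<exists>n. t \<in> {0..1} - cantor_stage n)"
    by (auto simp: cantor_set_def)
  also have "\<dots> \<longleftrightarrow> (\<exists>L. t \<in> gap L)"
    unfolding not_cantor_stage_iff by (metis lessI)
  finally show ?thesis .
qed

lemma closed_gaps_disjoint:
  assumes "t \<in> {gap_lo L..gap_hi L}" "t \<in> {gap_lo M..gap_hi M}"
  shows "L = M"
  using assms gap_separated[of L M] by fastforce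

lemma gap_ends_in_cantor_set: "t \<in> {gap_lo L, gap_hi L} \<Longrightarrow> t \<notin> {0..1} - cantor_set"
  unfolding not_cantor_set_iff
proof
  assume t: "t \<in> {gap_lo L, gap_hi L}" and "\<exists>M. t \<in> gap M"
  then obtain M where M: "t \<in> gap M" by blast
  moreover have "L = M"
    using t M gap_less[of L] by (intro closed_gaps_disjoint[of t]) auto
  ultimately show False using t by auto
qed

text \<open>
  Each gap is a connected subset of the complement, and a larger connected subset would contain one
  of its end points, which lie in the Cantor set.
\<close>
lemma components_cantor_complement: "components ({0..1} - cantor_set) = range gap"
proof -
  let ?S = "{0..1} - cantor_set"
  have "connected_component_set ?S t = gap L" if t: "t \<in> gap L" for t L
  proof
    have sub: "gap L \<subseteq> ?S" using not_cantor_set_iff by blast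
    then show "gap L \<subseteq> connected_component_set ?S t"
      using t by (intro connected_component_maximal) auto
    show "connected_component_set ?S t \<subseteq> gap L"
    proof
      fix s assume s: "s \<in> connected_component_set ?S t"
      have tt: "t \<in> connected_component_set ?S t"
        using sub t by (simp add: connected_component_refl_eq subset_iff)
      have Icc: "{a..b} \<subseteq> ?S" if "a \<in> connected_component_set ?S t" "b \<in> connected_component_set ?S t" for a b
        using connected_contains_Icc[OF connected_connected_component that]
          connected_component_subset by (meson subset_trans)
      have "gap_lo L \<notin> ?S" "gap_hi L \<notin> ?S" using gap_ends_in_cantor_set[of _ L] by blast+
      then have "gap_lo L \<notin> {s..t}" "gap_hi L \<notin> {t..s}"
        using Icc[OF s tt] Icc[OF tt s] by blast+
      then show "s \<in> gap L" using t by auto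
    qed
  qed
  note component = this
  show ?thesis
  proof (intro equalityI subsetI)
    fix J assume "J \<in> components ?S"
    then obtain t where t: "t \<in> ?S" "J = connected_component_set ?S t" unfolding components_iff by blast
    obtain L where "t \<in> gap L" using t(1) unfolding not_cantor_set_iff ..
    then have "J = gap L" using t(2) component by simp
    then show "J \<in> range gap" by blast
  next
    fix J assume "J \<in> range gap"
    then obtain L where J: "J = gap L" by blast
    obtain t where t: "t \<in> gap L" using dense[OF gap_less[of L]] by auto
    then have "t \<in> ?S" using not_cantor_set_iff by blast
    from componentsI[OF this] show "J \<in> components ?S" unfolding component[OF t] J .
  qed
qed

text \<open>
  Within one level the gaps are counted from the left by reading the word as a binary number; \<open>node\<close>
  is the resulting number of the gap, counted through all levels (the root has number 1, and
  \<open>node\<close> reads the word with an additional leading digit 1).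
\<close>
primrec bits :: "bool list \<Rightarrow> nat" where
  "bits [] = 0"
| "bits (x # L) = (if x then 2 ^ length L else 0) + bits L"

definition node :: "bool list \<Rightarrow> nat" where
  "node L = 2 ^ length L + bits L"

lemma bits_less: "bits L < 2 ^ length L"
  by (induction L) auto

lemma bits_inj: "length L = length M \<Longrightarrow> bits L = bits M \<Longrightarrow> L = M"
proof (induction L M rule: list_induct2)
  case (Cons x L y M)
  then show ?case using bits_less[of L] bits_less[of M] by (auto split: if_splits)
qed simp

lemma bits_surj: "k < 2 ^ n \<Longrightarrow> \<exists>L. length L = n \<and> bits L = k"
proof (induction n arbitrary: k)
  case (Suc n)
  show ?case
  proof (cases "k < 2 ^ n")
    case True
    then obtain L where "length L = n" "bits L = k" using Suc.IH by blast
    then show ?thesis by (intro exI[of _ "False # L"]) simp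
  next
    case False
    then have "k - 2 ^ n < 2 ^ n" using Suc.prems by simp
    then obtain L where "length L = n" "bits L = k - 2 ^ n" using Suc.IH by blast
    then show ?thesis using False by (intro exI[of _ "True # L"]) simp
  qed
qed simp

lemma node_pos: "1 \<le> node L"
  by (simp add: node_def Suc_le_eq add_pos_nonneg)

lemma inj_node: "inj node"
proof
  fix L M assume eq: "node L = node M"
  have less: "node L < node M" if "length L < length M" for L M
  proof -
    have "node L < 2 ^ Suc (length L)" using bits_less[of L] by (simp add: node_def)
    also have "(2::nat) ^ Suc (length L) \<le> 2 ^ length M" using that by (intro power_increasing) auto
    finally show ?thesis by (simp add: node_def)
  qed
  then have "length L = length M" using eq by (metis less_irrefl linorder_neqE_nat)
  then show "L = M" using eq bits_inj by (simp add: node_def)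
qed

lemma gap_lo_le_iff: "length L = length M \<Longrightarrow> gap_lo L \<le> gap_lo M \<longleftrightarrow> bits L \<le> bits M"
proof (induction L M rule: list_induct2)
  case (Cons x L y M)
  have "gap_lo L < gap_lo M + 2" "gap_lo M < gap_lo L + 2"
    using gap_bounds[of L] gap_bounds[of M] gap_less[of L] gap_less[of M] by linarith+
  moreover have "bits L < 2 ^ length M + bits M" "bits M < 2 ^ length L + bits L"
    using bits_less[of L] bits_less[of M] Cons.hyps by auto
  ultimately show ?case using Cons by (cases x; cases y) auto
qed simp

lemma inj_gap: "gap L = gap M \<Longrightarrow> L = M"
proof -
  assume eq: "gap L = gap M"
  obtain t where t: "t \<in> gap L" using dense[OF gap_less[of L]] by auto
  then have "t \<in> gap M" by (simp only: eq)
  then show "L = M" using t by (intro closed_gaps_disjoint[of t]) auto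
qed

lemma cantor_gaps_eq: "cantor_gaps (Suc n) = gap ` {L. length L = n}"
proof -
  have "diameter (gap L) = 1 / 3 ^ Suc n \<longleftrightarrow> length L = n" for L
    using gap_less[of L] by (auto simp: gap_hi_def)
  then show ?thesis unfolding cantor_gaps_def components_cantor_complement by auto
qed

lemma Inf_gap: "Inf (gap L) = gap_lo L" and Sup_gap: "Sup (gap L) = gap_hi L"
  using gap_less by simp_all

lemma card_gaps_upto:
  "card {J \<in> cantor_gaps (Suc (length L)). Inf J \<le> Inf (gap L)} = Suc (bits L)"
proof -
  let ?W = "{M. length M = length L \<and> bits M \<le> bits L}"
  have "{J \<in> cantor_gaps (Suc (length L)). Inf J \<le> Inf (gap L)} = gap ` ?W"
  proof -
    have "Inf (gap M) \<le> Inf (gap L) \<longleftrightarrow> bits M \<le> bits L" if "length M = length L" for M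
      unfolding Inf_gap by (rule gap_lo_le_iff[OF that])
    then show ?thesis unfolding cantor_gaps_eq by blast
  qed
  moreover have "inj_on gap ?W" using inj_gap by (intro inj_onI)
  ultimately have "card {J \<in> cantor_gaps (Suc (length L)). Inf J \<le> Inf (gap L)} = card ?W"
    by (simp only: card_image)
  also have "\<dots> = card (bits ` ?W)"
  proof (rule card_image[symmetric], rule inj_onI)
    fix M M' assume "M \<in> ?W" "M' \<in> ?W" "bits M = bits M'"
    then show "M = M'" by (intro bits_inj) auto
  qed
  also have "bits ` ?W = {..bits L}"
  proof (intro equalityI subsetI)
    fix k assume "k \<in> {..bits L}"
    then have "k < 2 ^ length L" using bits_less[of L] by simp
    then obtain M where "length M = length L" "bits M = k" using bits_surj by blast
    then show "k \<in> bits ` ?W" using \<open>k \<in> {..bits L}\<close> by auto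
  qed auto
  finally show ?thesis by simp
qed

lemma cantor_gap_eq: "cantor_gap (Suc (length L)) (Suc (bits L)) = gap L"
  unfolding cantor_gap_def
proof (rule the_equality)
  show "gap L \<in> cantor_gaps (Suc (length L)) \<and>
      card {J \<in> cantor_gaps (Suc (length L)). Inf J \<le> Inf (gap L)} = Suc (bits L)"
    unfolding card_gaps_upto unfolding cantor_gaps_eq by blast
next
  fix J assume J: "J \<in> cantor_gaps (Suc (length L)) \<and>
      card {J' \<in> cantor_gaps (Suc (length L)). Inf J' \<le> Inf J} = Suc (bits L)"
  then obtain M where M: "J = gap M" "length M = length L" unfolding cantor_gaps_eq by blast
  then have "Suc (bits M) = Suc (bits L)" using J card_gaps_upto[of M] by metis
  then show "J = gap L" using M bits_inj by blast
qed

section \<open>The Hawaiian earring\<close>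
lemma ell_eq: "ell n t = ((1 - cos (2 * pi * t)) / real n, - sin (2 * pi * t) / real n)"
proof -
  have "pi + 2 * pi * t = 2 * pi * t + pi" by simp
  then show ?thesis unfolding ell_def by (simp add: diff_divide_distrib)
qed

lemma continuous_ell: "continuous_on S (ell n)"
  unfolding ell_def by (intro continuous_intros)

lemma ell_in_hcircle: "ell n t \<in> hcircle n"
proof (cases "n = 0")
  case True
  then show ?thesis by (simp add: ell_def hcircle_def)
next
  case False
  have "dist (1 / real n, 0) (ell n t) = sqrt (\<bar>cos (2 * pi * t) / real n\<bar>\<^sup>2 + \<bar>sin (2 * pi * t) / real n\<bar>\<^sup>2)"
    by (simp add: ell_eq dist_Pair_Pair dist_real_def diff_divide_distrib)
  also have "\<bar>cos (2 * pi * t) / real n\<bar>\<^sup>2 + \<bar>sin (2 * pi * t) / real n\<bar>\<^sup>2 = (1 / real n)\<^sup>2"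
    by (simp add: power_divide add_divide_distrib[symmetric])
  finally show ?thesis by (simp add: hcircle_def)
qed

lemma ell_in_earring: "1 \<le> n \<Longrightarrow> ell n t \<in> earring"
  using ell_in_hcircle by (auto simp: earring_def)

lemma ell_ends [simp]: "ell n 0 = b0" "ell n 1 = b0"
  by (auto simp: ell_eq b0_def)

lemma ell_eq_b0D:
  assumes "1 \<le> n" "t \<in> {0..1}" "ell n t = b0"
  shows "t = 0 \<or> t = 1"
proof -
  have "cos (2 * pi * t) = 1" using assms by (simp add: ell_eq b0_def)
  then obtain k :: int where "2 * pi * t = of_int k * 2 * pi" by (auto simp: cos_one_2pi_int)
  then have "t = of_int k" by simp
  then have "0 \<le> k" "k \<le> 1" using assms(2) by simp_all
  then have "k = 0 \<or> k = 1" by linarith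
  then show ?thesis using \<open>t = of_int k\<close> by auto
qed

text \<open>
  Away from \<open>b0\<close> a point \<open>(x, y)\<close> of the earring determines its circle, as \<open>x^2 + y^2 = 2 * x / n\<close> on the
  \<open>n\<close>-th one, and then its angle.
\<close>
lemma ell_inj:
  assumes n: "1 \<le> n" "1 \<le> m" and t: "t \<in> {0..1}" "u \<in> {0..1}" and eq: "ell n t = ell m u"
  shows "n = m \<and> t = u \<or> ell n t = b0"
proof (cases "ell n t = b0")
  case False
  define x y where "x = fst (ell n t)" and "y = snd (ell n t)"
  have norm: "x\<^sup>2 + y\<^sup>2 = 2 * x / real k" if "1 \<le> k" "x = fst (ell k s)" "y = snd (ell k s)" for k s
  proof -
    have "(1 - cos (2 * pi * s))\<^sup>2 + (sin (2 * pi * s))\<^sup>2 = 2 * (1 - cos (2 * pi * s))"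
      by (simp add: sin_squared_eq power2_eq_square algebra_simps)
    then have "((1 - cos (2 * pi * s)) / real k)\<^sup>2 + (sin (2 * pi * s) / real k)\<^sup>2 = 2 * (1 - cos (2 * pi * s)) / (real k)\<^sup>2"
      by (simp add: power_divide add_divide_distrib[symmetric])
    then show ?thesis using that by (simp add: ell_eq power2_eq_square)
  qed
  have "x \<noteq> 0"
  proof
    assume "x = 0"
    then have "y = 0" using norm[of n t] n by (simp add: x_def y_def)
    then show False using \<open>x = 0\<close> False by (simp add: x_def y_def b0_def prod_eq_iff)
  qed
  moreover have "2 * x / real n = 2 * x / real m"
    using norm[of n t] norm[of m u] n eq by (simp add: x_def y_def)
  ultimately have nm: "n = m" using n by (simp add: field_simps)
  then have "cos (2 * pi * t) = cos (2 * pi * u)" "sin (2 * pi * t) = sin (2 * pi * u)"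
    using eq n by (simp_all add: ell_eq)
  then obtain k :: int where "2 * pi * t = 2 * pi * u + 2*pi * of_int k"
    using sin_cos_eq_iff[of "2 * pi * t" "2 * pi * u"] by auto
  then have "2 * pi * t = 2 * pi * (u + of_int k)" by (simp add: algebra_simps)
  then have k: "t = u + of_int k" by simp
  have "t \<noteq> 0" "t \<noteq> 1" using False by auto
  moreover have "u \<noteq> 0" "u \<noteq> 1" using False eq by auto
  ultimately have "- 1 < real_of_int k" "real_of_int k < 1" using k t by auto
  then have "k = 0" by linarith
  then show ?thesis using nm k by simp
qed simp

lemma earring_ell: "z \<in> earring \<Longrightarrow> \<exists>n\<ge>1. \<exists>t\<in>{0..1}. z = ell n t"
proof -
  assume "z \<in> earring"
  then obtain n where n: "1 \<le> n" and z: "z \<in> hcircle n" by (auto simp: earring_def)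
  obtain x y where xy: "z = (x, y)" by (cases z)
  have "sqrt ((1 / real n - x)\<^sup>2 + y\<^sup>2) = 1 / real n"
    using z by (simp add: xy hcircle_def dist_Pair_Pair dist_real_def)
  then have "(1 / real n - x)\<^sup>2 + y\<^sup>2 = (1 / real n)\<^sup>2"
    by (metis real_sqrt_pow2 sum_power2_ge_zero)
  then have "(real n)\<^sup>2 * ((1 / real n - x)\<^sup>2 + y\<^sup>2) = 1" using n by (simp add: power_divide)
  moreover have "(real n)\<^sup>2 * ((1 / real n - x)\<^sup>2 + y\<^sup>2) = (1 - real n * x)\<^sup>2 + (- real n * y)\<^sup>2"
    using n by (simp add: power2_eq_square field_simps)
  ultimately have "(1 - real n * x)\<^sup>2 + (- real n * y)\<^sup>2 = 1" by simp
  then obtain s where s: "0 \<le> s" "s < 2 * pi" "1 - real n * x = cos s" "- real n * y = sin s"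
    using sincos_total_2pi by metis
  have "ell n (s / (2 * pi)) = z"
    using s(3,4) n by (simp add: ell_eq xy field_simps)
  moreover have "s / (2 * pi) \<in> {0..1}" using s by (simp add: field_simps)
  ultimately show ?thesis using n by metis
qed

lemma earring_subset_plus: "earring \<subseteq> earring_plus"
  by (simp add: earring_plus_def)

lemma ell_loop: "1 \<le> n \<Longrightarrow> ell n \<in> loops_at earring b0"
  using ell_in_earring continuous_ell
  by (auto simp: loops_at_def path_def path_image_def pathstart_def pathfinish_def)

lemma dist_ell: "1 \<le> n \<Longrightarrow> dist b0 (ell n t) \<le> 2 / real n"
proof -
  assume n: "1 \<le> n"
  have "dist b0 (ell n t) \<le> dist b0 (1 / real n, 0) + dist (1 / real n, 0) (ell n t)"
    by (rule dist_triangle)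
  also have "dist (1 / real n, 0) (ell n t) = 1 / real n"
    using ell_in_hcircle[of n t] by (simp add: hcircle_def)
  also have "dist b0 (1 / real n, 0) = 1 / real n" by (simp add: b0_def dist_Pair_Pair)
  finally show ?thesis by simp
qed

lemma null_loops_ell:
  assumes "inj \<phi>" "\<And>i. 1 \<le> \<phi> i"
  shows "null_loops earring b0 (\<lambda>i. ell (\<phi> i))"
proof -
  have "finite {i. \<not> ell (\<phi> i) ` {0..1} \<subseteq> U}" if U: "open U" "b0 \<in> U" for U
  proof -
    obtain r where r: "0 < r" "ball b0 r \<subseteq> U" using U unfolding open_contains_ball by blast
    obtain m :: nat where m: "2 / r < real m" using reals_Archimedean2 by blast
    have "\<phi> i \<le> m" if "\<not> ell (\<phi> i) ` {0..1} \<subseteq> U" for i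
    proof (rule ccontr)
      assume "\<not> \<phi> i \<le> m"
      then have "2 / r < real (\<phi> i)" using m by simp
      then have "2 / real (\<phi> i) < r" using r assms(2)[of i] by (simp add: field_simps)
      then have "ell (\<phi> i) t \<in> ball b0 r" for t
        using dist_ell[OF assms(2)[of i], of t] by simp
      then show False using that r by blast
    qed
    then have "{i. \<not> ell (\<phi> i) ` {0..1} \<subseteq> U} \<subseteq> \<phi> -` {..m}" by auto
    moreover have "finite (\<phi> -` {..m})" by (rule finite_vimageI[OF _ assms(1)]) simp
    ultimately show ?thesis by (rule finite_subset)
  qed
  then show ?thesis using ell_loop[OF assms(2)] by (simp add: null_loops_def null_at_def)
qed

text \<open>
  The intervals of \<open>ell_inf\<close>, numbered from 0.
\<close>
definition harmonic_lo :: "nat \<Rightarrow> real" where "harmonic_lo i = real i / (real i + 1)"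
definition harmonic_hi :: "nat \<Rightarrow> real" where "harmonic_hi i = (real i + 1) / (real i + 2)"

lemma harmonic_bounds: "0 \<le> harmonic_lo i" "harmonic_lo i < harmonic_hi i" "harmonic_hi i < 1"
  by (simp_all add: harmonic_lo_def harmonic_hi_def field_simps)

lemma harmonic_ordered:
  assumes "i < j" shows "harmonic_hi i \<le> harmonic_lo j"
proof -
  have "real i + 1 \<le> real j" using assms by linarith
  then show ?thesis by (simp add: harmonic_lo_def harmonic_hi_def field_simps)
qed

lemma harmonic_separated: "i \<noteq> j \<Longrightarrow> harmonic_hi i \<le> harmonic_lo j \<or> harmonic_hi j \<le> harmonic_lo i"
  using harmonic_ordered by (metis linorder_neqE_nat)

lemma harmonic_cover:
  assumes "t \<in> {0..<1}" obtains i where "t \<in> {harmonic_lo i..harmonic_hi i}"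
proof -
  define i where "i = nat \<lfloor>t / (1 - t)\<rfloor>"
  have "0 \<le> t / (1 - t)" using assms by simp
  then have "real i \<le> t / (1 - t)" "t / (1 - t) < real i + 1"
    unfolding i_def by linarith+
  then have "real i * (1 - t) \<le> t" "t \<le> (real i + 1) * (1 - t)" using assms by (auto simp: field_simps)
  then have "t \<in> {harmonic_lo i..harmonic_hi i}"
    by (auto simp: harmonic_lo_def harmonic_hi_def field_simps)
  then show ?thesis by (rule that)
qed

abbreviation iprod_seq :: "'a \<Rightarrow> (nat \<Rightarrow> real \<Rightarrow> 'a) \<Rightarrow> real \<Rightarrow> 'a" where
  "iprod_seq x \<equiv> iprod x harmonic_lo harmonic_hi"

abbreviation iprod_cantor :: "'a \<Rightarrow> (bool list \<Rightarrow> real \<Rightarrow> 'a) \<Rightarrow> real \<Rightarrow> 'a" where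
  "iprod_cantor x \<equiv> iprod x gap_lo gap_hi"

lemma ell_inf_eq:
  assumes "t \<in> {0..1}"
  shows "ell_inf t = iprod_seq b0 (\<lambda>i. ell (Suc i)) t"
proof (cases "t = 1")
  case True
  have "iprod_seq b0 (\<lambda>i. ell (Suc i)) 1 = b0"
    by (rule iprod_base[OF ell_loop harmonic_bounds(2)])
       (use harmonic_bounds(3) in \<open>auto simp: not_less less_imp_le\<close>)
  then show ?thesis using True by (simp add: ell_inf_def)
next
  case False
  let ?w = "iprod_seq b0 (\<lambda>i. ell (Suc i)) t"
  have val: "?w = on_interval (ell (Suc i)) (harmonic_lo i) (harmonic_hi i) t"
    if "t \<in> {harmonic_lo i..harmonic_hi i}" for i
    unfolding on_interval_def
    using iprod_eq[where e = "\<lambda>i. ell (Suc i)" and a = harmonic_lo and b = harmonic_hi and i = i,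
        OF ell_loop harmonic_bounds(2) _ that]
      harmonic_separated by simp
  have lohi: "(real n - 1) / real n = harmonic_lo (n - 1)" "real n / (real n + 1) = harmonic_hi (n - 1)"
    if "1 \<le> n" for n
    using that by (simp_all add: harmonic_lo_def harmonic_hi_def of_nat_diff)
  obtain i where i: "t \<in> {harmonic_lo i..harmonic_hi i}"
    using assms False harmonic_cover[of t] by auto
  have "(THE w. \<exists>n\<ge>1. t \<in> {(real n - 1) / real n .. real n / (real n + 1)} \<and>
             w = on_interval (ell n) ((real n - 1) / real n) (real n / (real n + 1)) t) = ?w"
  proof (rule the_equality)
    show "\<exists>n\<ge>1. t \<in> {(real n - 1) / real n .. real n / (real n + 1)} \<and>
             ?w = on_interval (ell n) ((real n - 1) / real n) (real n / (real n + 1)) t"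
      using i val[OF i] lohi[of "Suc i"] by (intro exI[of _ "Suc i"]) simp
  next
    fix w assume "\<exists>n\<ge>1. t \<in> {(real n - 1) / real n .. real n / (real n + 1)} \<and>
             w = on_interval (ell n) ((real n - 1) / real n) (real n / (real n + 1)) t"
    then obtain n where n: "1 \<le> n" "t \<in> {harmonic_lo (n-1) .. harmonic_hi (n-1)}"
      "w = on_interval (ell n) (harmonic_lo (n-1)) (harmonic_hi (n-1)) t"
      using lohi by metis
    then show "w = ?w" using val[OF n(2)] by simp
  qed
  then show ?thesis using False by (simp add: ell_inf_def)
qed

lemma gap_separated_le: "L \<noteq> M \<Longrightarrow> gap_hi L \<le> gap_lo M \<or> gap_hi M \<le> gap_lo L"
  using gap_separated by (metis less_imp_le)

lemma ell_tau_eq: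
  assumes "t \<in> {0..1}"
  shows "ell_tau t = iprod_cantor b0 (\<lambda>L. ell (node L)) t"
proof (cases "t \<in> cantor_set")
  case True
  then have "t \<notin> gap L" for L using not_cantor_set_iff[of t] by blast
  then have "iprod_cantor b0 (\<lambda>L. ell (node L)) t = b0"
    by (rule iprod_base[OF ell_loop[OF node_pos] gap_less])
  then show ?thesis using True by (simp add: ell_tau_def)
next
  case False
  let ?w = "iprod_cantor b0 (\<lambda>L. ell (node L)) t"
  obtain L where L: "t \<in> gap L" using assms False not_cantor_set_iff[of t] by blast
  have val: "?w = on_interval (ell (node L)) (gap_lo L) (gap_hi L) t"
    unfolding on_interval_def
    using iprod_eq[where e = "\<lambda>L. ell (node L)" and a = gap_lo and b = gap_hi and i = L and t = t, OF ell_loop[OF node_pos] gap_less]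
      gap_separated_le L by simp
  have clos: "closure (gap M) = {gap_lo M..gap_hi M}" for M
    using gap_less by (intro closure_greaterThanLessThan)
  have "(THE w. \<exists>n\<ge>1. \<exists>k\<in>{1..2 ^ (n - 1)}. t \<in> closure (cantor_gap n k) \<and>
             w = on_interval (ell (2 ^ (n - 1) + k - 1)) (Inf (cantor_gap n k)) (Sup (cantor_gap n k)) t) = ?w"
  proof (rule the_equality)
    show "\<exists>n\<ge>1. \<exists>k\<in>{1..2 ^ (n - 1)}. t \<in> closure (cantor_gap n k) \<and>
             ?w = on_interval (ell (2 ^ (n - 1) + k - 1)) (Inf (cantor_gap n k)) (Sup (cantor_gap n k)) t"
    proof (intro exI[of _ "Suc (length L)"] conjI bexI[of _ "Suc (bits L)"])
      show "t \<in> closure (cantor_gap (Suc (length L)) (Suc (bits L)))"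
        unfolding cantor_gap_eq clos using L by auto
      show "?w = on_interval (ell (2 ^ (Suc (length L) - 1) + Suc (bits L) - 1))
          (Inf (cantor_gap (Suc (length L)) (Suc (bits L))))
          (Sup (cantor_gap (Suc (length L)) (Suc (bits L)))) t"
        unfolding cantor_gap_eq Inf_gap Sup_gap val by (simp add: node_def)
      show "Suc (bits L) \<in> {1..2 ^ (Suc (length L) - 1)}"
        using bits_less[of L] by simp
    qed simp
  next
    fix w assume "\<exists>n\<ge>1. \<exists>k\<in>{1..2 ^ (n - 1)}. t \<in> closure (cantor_gap n k) \<and>
             w = on_interval (ell (2 ^ (n - 1) + k - 1)) (Inf (cantor_gap n k)) (Sup (cantor_gap n k)) t"
    then obtain n k where nk: "1 \<le> n" "k \<in> {1..2 ^ (n - 1)}" "t \<in> closure (cantor_gap n k)"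
      "w = on_interval (ell (2 ^ (n - 1) + k - 1)) (Inf (cantor_gap n k)) (Sup (cantor_gap n k)) t"
      by blast
    have "k - 1 < 2 ^ (n - 1)" using nk(2) by auto
    then obtain M where M: "length M = n - 1" "bits M = k - 1" using bits_surj by blast
    have n: "n = Suc (length M)" and k: "k = Suc (bits M)" using M nk by auto
    have "M = L"
      using nk(3) L unfolding n k cantor_gap_eq clos by (intro closed_gaps_disjoint[of t]) auto
    then show "w = ?w"
      using nk(4) val unfolding n k cantor_gap_eq Inf_gap Sup_gap by (simp add: node_def)
  qed
  then show ?thesis using False by (simp add: ell_tau_def)
qed

lemma ell_map_ell:
  assumes "1 \<le> n" "t \<in> {0..1}" shows "ell_map \<phi> (ell n t) = ell (\<phi> n) t"
  unfolding ell_map_def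
proof (rule the_equality)
  fix w assume "\<exists>m\<ge>1. \<exists>u\<in>{0..1}. ell n t = ell m u \<and> w = ell (\<phi> m) u"
  then obtain m u where m: "1 \<le> m" "u \<in> {0..1}" "ell n t = ell m u" "w = ell (\<phi> m) u" by blast
  show "w = ell (\<phi> n) t"
  proof (cases "ell n t = b0")
    case True
    then have "t = 0 \<or> t = 1" "u = 0 \<or> u = 1" using ell_eq_b0D m assms by metis+
    then show ?thesis using m(4) by auto
  next
    case False
    then show ?thesis using ell_inj[OF assms(1) m(1) assms(2) m(2,3)] m(4) by simp
  qed
qed (use assms in blast)

lemma ell_map_b0: "ell_map \<phi> b0 = b0"
  using ell_map_ell[of 1 0 \<phi>] by simp

section \<open>Maps out of the test space\<close>

text \<open>
  A continuous surjection from a compact space to a Hausdorff space is a quotient map.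
\<close>
lemma continuous_on_compact_quotient:
  fixes s :: "'z::topological_space \<Rightarrow> 'y::t2_space" and f :: "'y \<Rightarrow> 'a::topological_space"
  assumes K: "compact K" and s: "continuous_on K s" and F: "continuous_on K F"
    and fs: "\<And>u. u \<in> K \<Longrightarrow> f (s u) = F u"
  shows "continuous_on (s ` K) f"
  unfolding continuous_on_closed_invariant
proof (intro allI impI)
  fix B :: "'a set" assume "closed B"
  then obtain A where A: "closed A" "A \<inter> K = F -` B \<inter> K"
    using F unfolding continuous_on_closed_invariant by blast
  have "compact (A \<inter> K)" using A(1) K by (rule closed_Int_compact)
  then have "compact (s ` (A \<inter> K))"
    by (intro compact_continuous_image continuous_on_subset[OF s]) auto
  then have "closed (s ` (A \<inter> K))" by (rule compact_imp_closed)
  moreover have "s ` (A \<inter> K) \<inter> s ` K = f -` B \<inter> s ` K"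
  proof -
    have A_iff: "u \<in> A \<longleftrightarrow> f (s u) \<in> B" if "u \<in> K" for u
    proof -
      have "u \<in> A \<longleftrightarrow> F u \<in> B" using A(2) that by blast
      then show ?thesis by (simp only: fs[OF that])
    qed
    show ?thesis
    proof (rule Set.set_eqI)
      fix y
      show "y \<in> s ` (A \<inter> K) \<inter> s ` K \<longleftrightarrow> y \<in> f -` B \<inter> s ` K"
        using A_iff by blast
    qed
  qed
  ultimately show "\<exists>A. closed A \<and> A \<inter> s ` K = f -` B \<inter> s ` K" by blast
qed

lemma loops_at_cong:
  assumes "p \<in> loops_at X x" "\<And>t. t \<in> {0..1} \<Longrightarrow> q t = p t"
  shows "q \<in> loops_at X x"
proof -
  have "homotopic_paths X p q"
    using assms by (intro homotopic_paths_eq) (auto simp: loops_at_def)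
  then show ?thesis
    using hclass_subset_loops_at[OF assms(1)] by (simp add: hclass_def)
qed

lemma loops_at_mono: "p \<in> loops_at S x \<Longrightarrow> S \<subseteq> T \<Longrightarrow> p \<in> loops_at T x"
  by (auto simp: loops_at_def)

lemma iprod_seq_loop:
  assumes "null_loops X x e" shows "iprod_seq x e \<in> loops_at X x"
  using assms harmonic_separated harmonic_bounds less_imp_le[OF harmonic_bounds(3)]
    loops_at_base[OF null_loopsD(1)[OF assms]]
  by (intro iprod_loop)

lemma iprod_cantor_loop:
  assumes "null_loops X x e" shows "iprod_cantor x e \<in> loops_at X x"
  using assms gap_separated_le gap_less less_imp_le[OF gap_bounds(1)] less_imp_le[OF gap_bounds(2)]
    loops_at_base[OF null_loopsD(1)[OF assms]]
  by (intro iprod_loop)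

lemma whisker_path_whisker: "whisker_path earring_plus b0_plus b0 whisker"
proof
  show "path whisker" unfolding path_def whisker_def by (intro continuous_intros)
  show "path_image whisker \<subseteq> earring_plus"
    by (auto simp: path_image_def whisker_def earring_plus_def)
qed (simp_all add: pathstart_def pathfinish_def whisker_def b0_plus_def b0_def)

lemma null_loops_ell_Suc: "null_loops earring b0 (\<lambda>i. ell (Suc i))"
  by (rule null_loops_ell) auto

lemma ell_inf_loop: "ell_inf \<in> loops_at earring b0"
  using iprod_seq_loop[OF null_loops_ell_Suc] ell_inf_eq by (rule loops_at_cong)

lemma ell_tau_loop: "ell_tau \<in> loops_at earring b0"
  using iprod_cantor_loop[OF null_loops_ell[OF inj_node node_pos]] ell_tau_eq by (rule loops_at_cong)

text \<open>
  A path together with a null family of loops at its end point extends to a map of the test space: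
  whisker and \<open>ell_inf\<close> together exhibit the test space as a quotient of the unit interval, and the
  composite of the prescribed map with this quotient map is again a path followed by an infinite
  product of a null family, hence continuous.
\<close>
lemma earring_plus_map:
  fixes X :: "'a::topological_space set"
  assumes \<alpha>: "whisker_path X x0 x1 \<alpha>" and e: "null_loops X x1 e"
  obtains f where "continuous_on earring_plus f" "f \<in> earring_plus \<rightarrow> X"
    "f b0_plus = x0" "f b0 = x1" "\<And>t. t \<in> {0..1} \<Longrightarrow> f (whisker t) = \<alpha> t"
    "\<And>n t. t \<in> {0..1} \<Longrightarrow> f (ell (Suc n) t) = e n t"
proof -
  interpret whisker_path X x0 x1 \<alpha> by (rule \<alpha>)
  interpret w: whisker_path earring_plus b0_plus b0 whisker by (rule whisker_path_whisker)
  \<comment> \<open>The whisker is the part with \<open>fst z \<le> 0\<close>; it includes \<open>b0\<close>, where the description by loops would also apply.\<close>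
  define f where "f = (\<lambda>z::real\<times>real. if fst z \<le> 0 then \<alpha> (fst z + 1)
    else (THE y. \<exists>n. \<exists>t\<in>{0..1}. z = ell (Suc n) t \<and> y = e n t))"
  have f_whisker: "f (whisker t) = \<alpha> t" if "t \<in> {0..1}" for t
    using that by (simp add: f_def whisker_def)
  have f_b0: "f b0 = x1" using finish by (simp add: f_def b0_def pathfinish_def)
  have e01: "e n 0 = x1" "e n 1 = x1" for n using loops_at_ends[OF null_loopsD(1)[OF e]] by auto
  have f_ell: "f (ell (Suc n) t) = e n t" if t: "t \<in> {0..1}" for n t
  proof (cases "ell (Suc n) t = b0")
    case True
    then have "t = 0 \<or> t = 1" using ell_eq_b0D[of "Suc n" t] t by simp
    then show ?thesis using True f_b0 e01 by auto
  next
    case False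
    have "cos (2 * pi * t) \<noteq> 1"
    proof
      assume c: "cos (2 * pi * t) = 1"
      then have "sin (2 * pi * t) = 0" using sin_cos_squared_add[of "2 * pi * t"] by simp
      then show False using c False by (simp add: ell_eq b0_def)
    qed
    then have "cos (2 * pi * t) < 1" using cos_le_one[of "2 * pi * t"] by linarith
    then have pos: "0 < fst (ell (Suc n) t)" by (simp add: ell_eq)
    have "(THE y. \<exists>m. \<exists>u\<in>{0..1}. ell (Suc n) t = ell (Suc m) u \<and> y = e m u) = e n t"
    proof (rule the_equality)
      fix y assume "\<exists>m. \<exists>u\<in>{0..1}. ell (Suc n) t = ell (Suc m) u \<and> y = e m u"
      then obtain m u where "u \<in> {0..1}" "ell (Suc n) t = ell (Suc m) u" "y = e m u" by blast
      then show "y = e n t" using ell_inj[of "Suc n" "Suc m" t u] t False by auto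
    qed (use t in blast)
    then show ?thesis using pos by (simp add: f_def)
  qed
  \<comment> \<open>The quotient map \<open>s\<close> onto the test space, and the path \<open>F\<close> that will be \<open>f \<circ> s\<close>.\<close>
  define s where "s = whisker +++ iprod_seq b0 (\<lambda>i. ell (Suc i))"
  define F where "F = \<alpha> +++ iprod_seq x1 e"
  have ploop: "iprod_seq b0 (\<lambda>i. ell (Suc i)) \<in> loops_at earring b0"
    by (rule iprod_seq_loop[OF null_loops_ell_Suc])
  have eloop: "iprod_seq x1 e \<in> loops_at X x1" by (rule iprod_seq_loop[OF e])
  have "path s" unfolding s_def using ploop w.path w.finish by (auto simp: loops_at_def)
  then have s: "continuous_on {0..1} s" by (simp add: path_def)
  have "path F" "path_image F \<subseteq> X"
    unfolding F_def using eloop path finish image by (auto simp: loops_at_def path_image_join)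
  then have F: "continuous_on {0..1} F" "F ` {0..1} \<subseteq> X" by (auto simp: path_def path_image_def)
  have "f (iprod_seq b0 (\<lambda>i. ell (Suc i)) t) = iprod_seq x1 e t" for t
    by (rule iprod_compose[where a = harmonic_lo and b = harmonic_hi and X = earring])
       (use ell_loop f_ell f_b0 harmonic_bounds harmonic_separated in auto)
  then have fs: "f (s u) = F u" if "u \<in> {0..1}" for u
    using that f_whisker by (simp add: s_def F_def joinpaths_def)
  have iprod_ell: "ell (Suc n) t \<in> iprod_seq b0 (\<lambda>i. ell (Suc i)) ` {0..1}" if t: "t \<in> {0..1}" for n t
  proof
    let ?u = "harmonic_lo n + t * (harmonic_hi n - harmonic_lo n)"
    have "0 \<le> t * (harmonic_hi n - harmonic_lo n)" "t * (harmonic_hi n - harmonic_lo n) \<le> harmonic_hi n - harmonic_lo n"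
      using t harmonic_bounds(2)[of n] by (auto intro: mult_left_le_one_le)
    then have u: "?u \<in> {harmonic_lo n..harmonic_hi n}" by auto
    then show "?u \<in> {0..1}" using harmonic_bounds(1,3)[of n] by auto
    have "iprod_seq b0 (\<lambda>i. ell (Suc i)) ?u = ell (Suc n) ((?u - harmonic_lo n) / (harmonic_hi n - harmonic_lo n))"
      using u harmonic_separated harmonic_bounds(2) ell_loop
      by (intro iprod_eq[where e = "\<lambda>i. ell (Suc i)" and a = harmonic_lo and b = harmonic_hi and X = earring]) auto
    also have "(?u - harmonic_lo n) / (harmonic_hi n - harmonic_lo n) = t"
      using harmonic_bounds(2)[of n] by simp
    finally show "ell (Suc n) t = iprod_seq b0 (\<lambda>i. ell (Suc i)) ?u" ..
  qed
  have "path_image s = path_image whisker \<union> path_image (iprod_seq b0 (\<lambda>i. ell (Suc i)))"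
    unfolding s_def using ploop w.finish by (intro path_image_join) (auto simp: loops_at_def)
  also have "path_image whisker = {-1..0} \<times> {0}"
  proof -
    have "(x, 0) \<in> path_image whisker" if "x \<in> {-1..0}" for x
      unfolding path_image_def using that by (intro image_eqI[of _ _ "x + 1"]) (auto simp: whisker_def)
    then show ?thesis by (auto simp: path_image_def whisker_def)
  qed
  also have "path_image (iprod_seq b0 (\<lambda>i. ell (Suc i))) = earring"
  proof
    show "path_image (iprod_seq b0 (\<lambda>i. ell (Suc i))) \<subseteq> earring" using ploop by (auto simp: loops_at_def)
    show "earring \<subseteq> path_image (iprod_seq b0 (\<lambda>i. ell (Suc i)))"
    proof
      fix z assume "z \<in> earring"
      then obtain n t where "1 \<le> n" "t \<in> {0..1}" "z = ell n t" using earring_ell by blast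
      then show "z \<in> path_image (iprod_seq b0 (\<lambda>i. ell (Suc i)))"
        using iprod_ell[of t "n - 1"] by (simp add: path_image_def)
    qed
  qed
  finally have im: "s ` {0..1} = earring_plus" by (auto simp: path_image_def earring_plus_def)
  show ?thesis
  proof
    show "continuous_on earring_plus f"
      using continuous_on_compact_quotient[OF _ s F(1) fs] im by simp
    show "f \<in> earring_plus \<rightarrow> X" unfolding im[symmetric] using fs F(2) by auto
    show "f b0_plus = x0" using f_whisker[of 0] start by (simp add: whisker_def b0_plus_def pathstart_def)
  qed (fact f_b0 f_whisker f_ell)+
qed

text \<open>
  Conversely, maps of the test space give null families, as continuous maps preserve nullity.
\<close>
lemma null_loops_compose:
  assumes f: "continuous_on S f" "f \<in> S \<rightarrow> X" and e: "null_loops S s0 e" and s0: "s0 \<in> S"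
  shows "null_loops X (f s0) (\<lambda>i. f \<circ> e i)"
proof -
  have "finite {i. \<not> (f \<circ> e i) ` {0..1} \<subseteq> U}" if U: "open U" "f s0 \<in> U" for U
  proof -
    obtain V where V: "open V" "V \<inter> S = f -` U \<inter> S"
      using f(1) U(1) unfolding continuous_on_open_invariant by blast
    then have "s0 \<in> V" using U(2) s0 by blast
    then have "finite {i. \<not> e i ` {0..1} \<subseteq> V}"
      using null_loopsD(2)[OF e] V(1) by (simp add: null_at_def)
    moreover have "{i. \<not> (f \<circ> e i) ` {0..1} \<subseteq> U} \<subseteq> {i. \<not> e i ` {0..1} \<subseteq> V}"
      using V(2) loops_at_in[OF null_loopsD(1)[OF e]] by fastforce
    ultimately show ?thesis by (rule finite_subset[rotated])
  qed
  then show ?thesis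
    using loops_at_compose[OF f null_loopsD(1)[OF e]] by (simp add: null_loops_def null_at_def)
qed

lemma null_loops_mono: "null_loops S x e \<Longrightarrow> S \<subseteq> T \<Longrightarrow> null_loops T x e"
  using loops_at_mono unfolding null_loops_def by blast

text \<open>
  The homotopy relation itself looks only at the values on \<open>[0,1]\<close>.
\<close>
lemma hclass_cong:
  assumes "\<And>t. t \<in> {0..1} \<Longrightarrow> p t = q t"
  shows "hclass X p = hclass X q"
  using assms unfolding hclass_def homotopic_paths pathstart_def pathfinish_def by auto

lemma whiskered_cong':
  assumes "\<And>t. t \<in> {0..1} \<Longrightarrow> \<alpha> t = \<beta> t" "\<And>t. t \<in> {0..1} \<Longrightarrow> p t = q t"
  shows "whiskered X \<alpha> p = whiskered X \<beta> q"
  unfolding whiskered_def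
  by (rule hclass_cong) (use assms in \<open>auto simp: joinpaths_def reversepath_def\<close>)

lemma induced_whiskered:
  assumes f: "continuous_on earring_plus f" "f \<in> earring_plus \<rightarrow> X" and p: "p \<in> loops_at earring b0"
  shows "induced X f (whiskered earring_plus whisker p) = whiskered X (f \<circ> whisker) (f \<circ> p)"
proof -
  interpret w: whisker_path earring_plus b0_plus b0 whisker by (rule whisker_path_whisker)
  have "whisker +++ p +++ reversepath whisker \<in> loops_at earring_plus b0_plus"
    by (rule w.whiskered_loop[OF loops_at_mono[OF p earring_subset_plus]])
  then have "induced X f (whiskered earring_plus whisker p) = hclass X (f \<circ> (whisker +++ p +++ reversepath whisker))"
    unfolding whiskered_def by (intro induced_hclass[OF f]) (auto simp: loops_at_def)
  then show ?thesis
    by (simp add: whiskered_def path_compose_join path_compose_reversepath)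
qed

text \<open>
  Closedness for test elements of the test space, in terms of null families. A test loop \<open>g n\<close> in the
  earring becomes an operation \<open>w n\<close> that forms a loop from a null family \<open>e\<close>, by substituting \<open>e i\<close> for
  \<open>ell (Suc i)\<close>; likewise \<open>g'\<close> becomes \<open>v\<close>.
\<close>
lemma tg_closed_earring_iff:
  fixes X :: "'a::topological_space set"
    and w :: "nat \<Rightarrow> 'a \<Rightarrow> (nat \<Rightarrow> real \<Rightarrow> 'a) \<Rightarrow> real \<Rightarrow> 'a"
  assumes N: "subgroup N (pi1 X x0)"
    and g: "\<And>n. 1 \<le> n \<Longrightarrow> g n \<in> loops_at earring b0" "g' \<in> loops_at earring b0"
    and wv: "\<And>f x1 e n t. \<lbrakk>f b0 = x1; \<And>i t. t \<in> {0..1} \<Longrightarrow> f (ell (Suc i) t) = e i t; t \<in> {0..1}\<rbrakk>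
      \<Longrightarrow> (1 \<le> n \<longrightarrow> f (g n t) = w n x1 e t) \<and> f (g' t) = v x1 e t"
  shows "tg_closed earring_plus b0_plus
      (generate (pi1 earring_plus b0_plus) ((\<lambda>n. whiskered earring_plus whisker (g n)) ` {1..}))
      (whiskered earring_plus whisker g') X x0 N \<longleftrightarrow>
    (\<forall>x1 \<alpha> e. whisker_path X x0 x1 \<alpha> \<and> null_loops X x1 e \<and> (\<forall>n\<ge>1. whiskered X \<alpha> (w n x1 e) \<in> N)
      \<longrightarrow> whiskered X \<alpha> (v x1 e) \<in> N)" (is "?tg \<longleftrightarrow> ?fam")
proof -
  interpret w: whisker_path earring_plus b0_plus b0 whisker by (rule whisker_path_whisker)
  let ?G = "(\<lambda>n. whiskered earring_plus whisker (g n)) ` {1..}"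
  have G: "?G \<subseteq> carrier (pi1 earring_plus b0_plus)"
    using w.whiskered_in_carrier loops_at_mono[OF g(1) earring_subset_plus] by auto
  have ind: "induced X f (whiskered earring_plus whisker (g n)) = whiskered X \<alpha> (w n x1 e)"
      "induced X f (whiskered earring_plus whisker g') = whiskered X \<alpha> (v x1 e)"
    if "continuous_on earring_plus f" "f \<in> earring_plus \<rightarrow> X" "f b0 = x1"
      "\<And>t. t \<in> {0..1} \<Longrightarrow> f (whisker t) = \<alpha> t"
      "\<And>i t. t \<in> {0..1} \<Longrightarrow> f (ell (Suc i) t) = e i t" "1 \<le> n" for f \<alpha> x1 e n
    unfolding induced_whiskered[OF that(1,2) g(1)[OF that(6)]] induced_whiskered[OF that(1,2) g(2)]
    using that(4,6) wv[of f x1 e, OF that(3) that(5)] by (auto intro!: whiskered_cong')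
  have gen: "induced X f ` generate (pi1 earring_plus b0_plus) ?G \<subseteq> N \<longleftrightarrow>
      (\<forall>n\<ge>1. induced X f (whiskered earring_plus whisker (g n)) \<in> N)"
    if f: "continuous_on earring_plus f" "f \<in> earring_plus \<rightarrow> X" "f b0_plus = x0" for f
    using induced_generate_subset_iff[OF f(1,2) w.x0_in G, of N] N f(3) by auto
  show ?thesis
  proof
    assume tg: ?tg
    show ?fam
    proof (intro allI impI, elim conjE)
      fix x1 \<alpha> and e :: "nat \<Rightarrow> real \<Rightarrow> 'a"
      assume \<alpha>: "whisker_path X x0 x1 \<alpha>" and e: "null_loops X x1 e"
        and w: "\<forall>n\<ge>1. whiskered X \<alpha> (w n x1 e) \<in> N"
      obtain f where f: "continuous_on earring_plus f" "f \<in> earring_plus \<rightarrow> X" "f b0_plus = x0"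
        "f b0 = x1" "\<And>t. t \<in> {0..1} \<Longrightarrow> f (whisker t) = \<alpha> t"
        "\<And>n t. t \<in> {0..1} \<Longrightarrow> f (ell (Suc n) t) = e n t"
        using earring_plus_map[OF \<alpha> e] by metis
      note i = ind[OF f(1,2,4,5,6)]
      have "induced X f ` generate (pi1 earring_plus b0_plus) ?G \<subseteq> N"
        unfolding gen[OF f(1-3)] using i(1) w by simp
      then have "induced X f (whiskered earring_plus whisker g') \<in> N"
        using tg f(1-3) by (simp add: tg_closed_def)
      then show "whiskered X \<alpha> (v x1 e) \<in> N" using i(2)[of 1] by simp
    qed
  next
    assume fam: ?fam
    show ?tg
      unfolding tg_closed_def
    proof (intro allI impI, elim conjE)
      fix f :: "real \<times> real \<Rightarrow> 'a"
      assume f: "continuous_on earring_plus f" "f \<in> earring_plus \<rightarrow> X" "f b0_plus = x0"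
        and gN: "induced X f ` generate (pi1 earring_plus b0_plus) ?G \<subseteq> N"
      let ?e = "\<lambda>i. f \<circ> ell (Suc i)"
      note i = ind[of f "f b0" "f \<circ> whisker" ?e, OF f(1,2)]
      have "whisker_path X x0 (f b0) (f \<circ> whisker)"
      proof
        show "path (f \<circ> whisker)"
          using f(1) w.path w.image by (intro path_continuous_image continuous_on_subset[OF f(1)])
        show "path_image (f \<circ> whisker) \<subseteq> X" using w.image f(2) by (auto simp: path_image_compose)
      qed (simp_all add: pathstart_compose pathfinish_compose w.start w.finish f(3))
      moreover have "null_loops X (f b0) ?e"
        using null_loops_mono[OF null_loops_ell_Suc earring_subset_plus] w.x1_in
        by (intro null_loops_compose[OF f(1,2)])
      moreover have "\<forall>n\<ge>1. whiskered X (f \<circ> whisker) (w n (f b0) ?e) \<in> N"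
        using gN i(1) unfolding gen[OF f] by simp
      ultimately have "whiskered X (f \<circ> whisker) (v (f b0) ?e) \<in> N" using fam by blast
      then show "induced X f (whiskered earring_plus whisker g') \<in> N" using i(2)[of 1] by simp
    qed
  qed
qed

section \<open>Operations on null families\<close>
lemma null_at_reindex:
  assumes "null_at x Z e" "inj \<phi>"
  shows "null_at x Z (\<lambda>i. e (\<phi> i))"
  unfolding null_at_def
proof (intro allI impI)
  fix U assume "open U \<and> x \<in> U"
  then have "finite {i. \<not> e i ` Z \<subseteq> U}" using assms(1) by (simp add: null_at_def)
  then have "finite (\<phi> -` {i. \<not> e i ` Z \<subseteq> U})" using assms(2) by (rule finite_vimageI)
  then show "finite {i. \<not> e (\<phi> i) ` Z \<subseteq> U}" by simp
qed

lemma null_loops_reindex: "null_loops X x e \<Longrightarrow> inj \<phi> \<Longrightarrow> null_loops X x (\<lambda>i. e (\<phi> i))"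
  by (simp add: null_loops_def null_at_reindex)

definition spread :: "'a \<Rightarrow> ('i \<Rightarrow> 'j) \<Rightarrow> ('i \<Rightarrow> real \<Rightarrow> 'a) \<Rightarrow> 'j \<Rightarrow> real \<Rightarrow> 'a" where
  "spread x \<phi> e j = (if j \<in> range \<phi> then e (inv_into UNIV \<phi> j) else (\<lambda>_. x))"

lemma spread_range: "inj \<phi> \<Longrightarrow> spread x \<phi> e (\<phi> i) = e i"
  by (simp add: spread_def)

lemma spread_const: "j \<notin> range \<phi> \<Longrightarrow> spread x \<phi> e j = (\<lambda>_. x)"
  by (simp add: spread_def)

lemma null_loops_spread:
  assumes e: "null_loops X x e" and x: "x \<in> X" and \<phi>: "inj \<phi>"
  shows "null_loops X x (spread x \<phi> e)"
proof -
  have "spread x \<phi> e j \<in> loops_at X x" for j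
    using null_loopsD(1)[OF e] loops_at_const[OF x] by (simp add: spread_def)
  moreover have "finite {j. \<not> spread x \<phi> e j ` {0..1} \<subseteq> U}" if U: "open U" "x \<in> U" for U
  proof -
    have "finite {i. \<not> e i ` {0..1} \<subseteq> U}"
      using null_loopsD(2)[OF e] U by (simp add: null_at_def)
    moreover have "{j. \<not> spread x \<phi> e j ` {0..1} \<subseteq> U} \<subseteq> \<phi> ` {i. \<not> e i ` {0..1} \<subseteq> U}"
    proof
      fix j assume j: "j \<in> {j. \<not> spread x \<phi> e j ` {0..1} \<subseteq> U}"
      then have "j \<in> range \<phi>" using U(2) spread_const[of j \<phi> x e] by auto
      then obtain i where "j = \<phi> i" by blast
      then show "j \<in> \<phi> ` {i. \<not> e i ` {0..1} \<subseteq> U}" using j spread_range[OF \<phi>, of x e i] by simp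
    qed
    ultimately show ?thesis by (rule finite_surj)
  qed
  ultimately show ?thesis by (simp add: null_loops_def null_at_def)
qed

lemma iprod_spread:
  assumes e: "\<And>i. e i \<in> loops_at X x" and \<phi>: "inj \<phi>"
    and ab: "\<And>j. a j < b j" and ord: "\<And>i j. i \<noteq> j \<Longrightarrow> b i \<le> a j \<or> b j \<le> a i"
  shows "iprod x a b (spread x \<phi> e) t = iprod x (\<lambda>i. a (\<phi> i)) (\<lambda>i. b (\<phi> i)) e t"
proof (cases "\<exists>i. t \<in> {a (\<phi> i)..b (\<phi> i)}")
  case True
  then obtain i where i: "t \<in> {a (\<phi> i)..b (\<phi> i)}" by blast
  have "x \<in> X" using loops_at_base e by metis
  then have l: "spread x \<phi> e j \<in> loops_at X x" for j
    using e loops_at_const[of x X] by (simp add: spread_def)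
  have "iprod x a b (spread x \<phi> e) t = spread x \<phi> e (\<phi> i) ((t - a (\<phi> i)) / (b (\<phi> i) - a (\<phi> i)))"
    by (rule iprod_eq[where X = X]) (use l ab ord i in auto)
  moreover have "iprod x (\<lambda>i. a (\<phi> i)) (\<lambda>i. b (\<phi> i)) e t = e i ((t - a (\<phi> i)) / (b (\<phi> i) - a (\<phi> i)))"
  proof (rule iprod_eq[where X = X and a = "\<lambda>i. a (\<phi> i)" and b = "\<lambda>i. b (\<phi> i)"])
    show "b (\<phi> i) \<le> a (\<phi> j) \<or> b (\<phi> j) \<le> a (\<phi> i)" if "i \<noteq> j" for j
      using that \<phi> by (intro ord) (auto simp: inj_def)
  qed (use e ab i in auto)
  ultimately show ?thesis by (simp add: spread_range[OF \<phi>])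
next
  case False
  have off: "t \<notin> {a (\<phi> i)<..<b (\<phi> i)}" for i
  proof
    assume "t \<in> {a (\<phi> i)<..<b (\<phi> i)}"
    then have "t \<in> {a (\<phi> i)..b (\<phi> i)}" by auto
    with False show False by blast
  qed
  have "iprod x (\<lambda>i. a (\<phi> i)) (\<lambda>i. b (\<phi> i)) e t = x"
    by (rule iprod_base[where X = X]) (use e ab off in auto)
  moreover have "spread x \<phi> e j (stretch (a j) (b j) t) = x" for j
  proof (cases "j \<in> range \<phi>")
    case True
    then obtain i where i: "j = \<phi> i" by blast
    then show ?thesis using off[of i] loop_stretch_outside[OF e[of i] ab[of j]] i spread_range[OF \<phi>] by metis
  qed (simp add: spread_const)
  then have "iprod x a b (spread x \<phi> e) t = x" unfolding iprod_def by (rule glue_eq_base)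
  ultimately show ?thesis by simp
qed

lemma null_loops_join:
  assumes e: "null_loops X x e" and d: "null_loops X x d"
  shows "null_loops X x (\<lambda>i. e i +++ d i)"
proof -
  have "finite {i. \<not> (e i +++ d i) ` {0..1} \<subseteq> U}" if U: "open U" "x \<in> U" for U
  proof -
    have "finite ({i. \<not> e i ` {0..1} \<subseteq> U} \<union> {i. \<not> d i ` {0..1} \<subseteq> U})"
      using null_loopsD(2)[OF e] null_loopsD(2)[OF d] U by (simp add: null_at_def)
    moreover have "(e i +++ d i) ` {0..1} \<subseteq> U" if "e i ` {0..1} \<subseteq> U" "d i ` {0..1} \<subseteq> U" for i
      using that path_image_join_subset[of "e i" "d i"] unfolding path_image_def by blast
    then have "{i. \<not> (e i +++ d i) ` {0..1} \<subseteq> U} \<subseteq> {i. \<not> e i ` {0..1} \<subseteq> U} \<union> {i. \<not> d i ` {0..1} \<subseteq> U}"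
      by blast
    ultimately show ?thesis by (rule finite_subset[rotated])
  qed
  then show ?thesis
    using loops_at_join[OF null_loopsD(1)[OF e] null_loopsD(1)[OF d]]
    by (simp add: null_loops_def null_at_def)
qed

lemma null_loops_reverse:
  assumes e: "null_loops X x e"
  shows "null_loops X x (\<lambda>i. reversepath (e i))"
proof -
  have "null_at x {0..1} (\<lambda>i. reversepath (e i))"
    by (rule null_at_subset[OF null_loopsD(2)[OF e]]) (auto simp: reversepath_def intro: bexI[of _ "1 - _"])
  then show ?thesis
    using loops_at_reverse[OF null_loopsD(1)[OF e]] by (simp add: null_loops_def)
qed

section \<open>Telescoping products\<close>
lemma harmonic_hi_eq: "harmonic_hi n = harmonic_lo (Suc n)"
  by (simp add: harmonic_lo_def harmonic_hi_def add.commute)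

text \<open>
  The product is \<open>E 0\<close> followed by the pairs of \<open>reversepath (E n)\<close> and \<open>E n\<close> for all \<open>n > 0\<close>. Each pair
  runs along \<open>E n\<close> backwards and forwards and is contracted within the image of \<open>E n\<close> to its end
  point \<open>x\<close>. All these contractions can be carried out at the same time because the images are null.
\<close>
lemma telescoping_homotopy:
  fixes E :: "nat \<Rightarrow> real \<Rightarrow> 'a::topological_space"
  assumes E: "null_loops X x E"
  shows "homotopic_paths X (iprod_seq x (\<lambda>n. E n +++ reversepath (E (Suc n)))) (E 0)"
proof -
  note El = null_loopsD(1)[OF E]
  have x: "x \<in> X" by (rule loops_at_base[OF El])
  have E01: "E n 0 = x" "E n 1 = x" for n using loops_at_ends[OF El] by auto
  let ?a = harmonic_lo
  define m where "m = (\<lambda>n. (?a n + ?a (Suc n)) / 2)"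
  have am: "?a n < m n" "m n < ?a (Suc n)" for n
    using harmonic_bounds(2)[of n] by (simp_all add: m_def harmonic_hi_eq)
  have mono: "?a i \<le> ?a j" if "i \<le> j" for i j
    using that harmonic_ordered[of i j] harmonic_bounds(2)[of i] by (cases "i = j") auto
  have m_less: "m i < ?a j" if "i < j" for i j
    using am(2)[of i] mono[of "Suc i" j] that by simp
  have a1: "?a n < 1" for n using harmonic_bounds(2,3)[of n] by simp
  \<comment> \<open>On \<open>[m n, m (Suc n)]\<close> the product traverses first \<open>reversepath (E (Suc n))\<close>, then \<open>E (Suc n)\<close>; the
  parameter of \<open>E (Suc n)\<close> at time \<open>t\<close> is \<open>v n t\<close>, which falls from 1 to 0 and rises back to 1.\<close>
  define v where "v = (\<lambda>n t. max (1 - stretch (m n) (?a (Suc n)) t) (stretch (?a (Suc n)) (m (Suc n)) t))"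
  \<comment> \<open>Raising the parameter to at least \<open>s = fst z\<close> contracts every excursion but the first to \<open>E (Suc k) 1 = x\<close>.\<close>
  define g where "g = (\<lambda>n (z::real\<times>real). case n of
      0 \<Rightarrow> E 0 (stretch (?a 0) (m 0) (snd z))
    | Suc k \<Rightarrow> E (Suc k) (max (fst z) (v k (snd z))))"
  let ?Z = "{0..1::real} \<times> {0..1::real}"
  let ?P = "iprod_seq x (\<lambda>n. E n +++ reversepath (E (Suc n)))"
  have v01: "v n t \<in> {0..1}" for n t
    using stretch_01[of "m n" "?a (Suc n)" t] stretch_01[of "?a (Suc n)" "m (Suc n)" t]
    by (auto simp: v_def)
  have v_left: "v n t = 1" if "t \<le> m n" for n t
  proof -
    have "stretch (m n) (?a (Suc n)) t = 0" by (rule stretch_left[OF am(2) that])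
    then show ?thesis using stretch_01[of "?a (Suc n)" "m (Suc n)" t] by (simp add: v_def)
  qed
  have v_right: "v n t = 1" if "m (Suc n) \<le> t" for n t
  proof -
    have "stretch (?a (Suc n)) (m (Suc n)) t = 1" by (rule stretch_right[OF am(1) that])
    then show ?thesis using stretch_01[of "m n" "?a (Suc n)" t] by (simp add: v_def)
  qed
  have g_off: "g 0 z = x" if "m 0 \<le> snd z" for z
    using that stretch_right[OF am(1)] E01 by (simp add: g_def)
  have g_off_Suc: "g (Suc k) z = x" if "z \<in> ?Z" "snd z \<le> m k \<or> m (Suc k) \<le> snd z" for k z
    using that v_left[of "snd z" k] v_right[of k "snd z"] E01 by (auto simp: g_def max_absorb2)
  have m_mono: "m i \<le> m j" if "i \<le> j" for i j
    using m_less[of i j] am(1)[of j] that by (cases "i = j") auto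
  have disj: "g i z = x \<or> g j z = x" if "z \<in> ?Z" "i \<noteq> j" for i j z
  proof -
    have *: "g i z = x \<or> g j z = x" if ij: "i < j" for i j
    proof -
      obtain k where k: "j = Suc k" "i \<le> k" using ij by (cases j) auto
      show ?thesis
      proof (cases "snd z \<le> m k")
        case True
        then show ?thesis using g_off_Suc[OF \<open>z \<in> ?Z\<close>] k by simp
      next
        case False
        then have "m i \<le> snd z" using m_mono[OF k(2)] by simp
        then show ?thesis using g_off g_off_Suc[OF \<open>z \<in> ?Z\<close>] by (cases i) auto
      qed
    qed
    show ?thesis using *[of i j] *[of j i] that(2) by (cases "i < j") auto
  qed
  have cont_stretch: "continuous_on S (\<lambda>z::real\<times>real. stretch a b (snd z))" if "a < b" for S a b
    unfolding stretch_def by (intro continuous_intros) (use that in auto)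
  have cont: "continuous_on ?Z (g n)" for n
  proof (cases n)
    case 0
    have "continuous_on ?Z (\<lambda>z. E 0 (stretch (?a 0) (m 0) (snd z)))"
    proof (rule continuous_on_compose2[OF null_loopsD(3)[OF E]])
      show "continuous_on ?Z (\<lambda>z. stretch (?a 0) (m 0) (snd z))" by (rule cont_stretch[OF am(1)])
    qed (use stretch_01 in blast)
    then show ?thesis by (simp add: g_def 0)
  next
    case (Suc k)
    have "continuous_on ?Z (\<lambda>z. E (Suc k) (max (fst z) (v k (snd z))))"
    proof (rule continuous_on_compose2[OF null_loopsD(3)[OF E]])
      show "continuous_on ?Z (\<lambda>z. max (fst z) (v k (snd z)))"
        unfolding v_def by (intro continuous_intros cont_stretch am)
      have "max (fst z) (v k (snd z)) \<in> {0..1}" if "z \<in> ?Z" for z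
        using that v01[of k "snd z"] by auto
      then show "(\<lambda>z. max (fst z) (v k (snd z))) ` ?Z \<subseteq> {0..1}" by blast
    qed
    then show ?thesis by (simp add: g_def Suc)
  qed
  have null: "null_at x ?Z g"
  proof (rule null_at_subset[OF null_loopsD(2)[OF E]])
    fix n z assume z: "z \<in> ?Z"
    show "\<exists>t\<in>{0..1}. g n z = E n t"
    proof (cases n)
      case 0
      then show ?thesis using stretch_01 by (auto simp: g_def)
    next
      case (Suc k)
      have "max (fst z) (v k (snd z)) \<in> {0..1}" using z v01[of k "snd z"] by auto
      then show ?thesis using Suc by (auto simp: g_def)
    qed
  qed
  have start: "glue x g (0, t) = ?P t" if t: "t \<in> {0..1}" for t
  proof (cases "t = 1")
    case True
    have "g n (0, 1) = x" for n
      using g_off[of "(0,1)"] g_off_Suc[of "(0,1)"] m_less[of _ "Suc _"] a1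
      by (cases n) (metis lessI less_imp_le less_trans snd_conv,
          metis atLeastAtMost_iff lessI less_imp_le less_trans mem_Times_iff fst_conv order_refl snd_conv zero_le_one)
    then have "glue x g (0, 1) = x" by (rule glue_eq_base)
    moreover have "?P 1 = x"
      by (rule iprod_base[where X = X])
         (use El harmonic_bounds in \<open>auto intro!: loops_at_join loops_at_reverse simp: not_less less_imp_le\<close>)
    ultimately show ?thesis using True by simp
  next
    case False
    then obtain n where n: "t \<in> {?a n..harmonic_hi n}" using t harmonic_cover[of t] by auto
    let ?u = "(t - ?a n) / (?a (Suc n) - ?a n)"
    have P: "?P t = (E n +++ reversepath (E (Suc n))) ?u"
      unfolding harmonic_hi_eq[symmetric]
      by (rule iprod_eq[where X = X and i = n and a = harmonic_lo and b = harmonic_hi])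
         (use El harmonic_bounds harmonic_separated n in \<open>auto intro!: loops_at_join loops_at_reverse\<close>)
    have z: "(0::real, t) \<in> ?Z" using t by simp
    have pos: "0 < ?a (Suc n) - ?a n" using am[of n] by simp
    show ?thesis
    proof (cases "t \<le> m n")
      case True
      have half: "?u \<le> 1/2" "2 * ?u = (t - ?a n) / (m n - ?a n)"
        using True pos by (auto simp: m_def field_simps)
      have "g j (0, t) = x" if jn: "j \<noteq> n" for j
      proof (cases "j < n")
        case True
        then have "m j \<le> t" using m_less[OF True] n by auto
        then show ?thesis using g_off g_off_Suc[OF z] by (cases j) auto
      next
        case False
        then obtain k where "j = Suc k" "n \<le> k" using False jn by (cases j) auto
        then show ?thesis using g_off_Suc[OF z, of k] True m_mono[of n k] by simp
      qed
      then have "glue x g (0, t) = g n (0, t)" by (rule glue_eqI)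
      also have "\<dots> = E n ((t - ?a n) / (m n - ?a n))"
      proof (cases n)
        case 0
        then show ?thesis using stretch_mid[OF am(1)[of n]] n True by (simp add: g_def)
      next
        case (Suc k)
        have "stretch (m k) (?a n) t = 1" using stretch_right[OF am(2)[of k]] n Suc by simp
        moreover have "stretch (?a n) (m n) t = (t - ?a n) / (m n - ?a n)"
          using stretch_mid[OF am(1)[of n]] n True by simp
        moreover have "0 \<le> (t - ?a n) / (m n - ?a n)" using n am(1)[of n] by simp
        ultimately show ?thesis by (simp add: g_def v_def Suc)
      qed
      also have "\<dots> = ?P t" unfolding P unfolding joinpaths_def using half by (simp only: if_True)
      finally show ?thesis .
    next
      case False
      have half: "\<not> ?u \<le> 1/2" "1 - (2 * ?u - 1) = 1 - (t - m n) / (?a (Suc n) - m n)"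
        using False pos by (auto simp: m_def field_simps)
      have "g j (0, t) = x" if jn: "j \<noteq> Suc n" for j
      proof (cases "j \<le> n")
        case True
        then have "m j \<le> t" using m_mono[OF True] False by auto
        then show ?thesis using g_off g_off_Suc[OF z] by (cases j) auto
      next
        case False
        then obtain k where "j = Suc k" "Suc n \<le> k" using False jn by (cases j) auto
        then show ?thesis
          using g_off_Suc[OF z, of k] n m_mono[of "Suc n" k] am(1)[of "Suc n"] by (simp add: harmonic_hi_eq)
      qed
      then have "glue x g (0, t) = g (Suc n) (0, t)" by (rule glue_eqI)
      also have "\<dots> = E (Suc n) (1 - (t - m n) / (?a (Suc n) - m n))"
      proof -
        have "stretch (?a (Suc n)) (m (Suc n)) t = 0"
          using stretch_left[OF am(1)[of "Suc n"]] n by (simp add: harmonic_hi_eq)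
        moreover have "stretch (m n) (?a (Suc n)) t = (t - m n) / (?a (Suc n) - m n)"
          using stretch_mid[OF am(2)[of n]] n False by (simp add: harmonic_hi_eq)
        moreover have "(t - m n) / (?a (Suc n) - m n) \<le> 1"
          using n am(2)[of n] by (simp add: harmonic_hi_eq)
        ultimately show ?thesis by (simp add: g_def v_def)
      qed
      also have "\<dots> = ?P t" unfolding P unfolding joinpaths_def reversepath_def using half by (simp only: if_False)
      finally show ?thesis .
    qed
  qed
  have finish: "glue x g (1, t) = E 0 (stretch (?a 0) (m 0) t)" if t: "t \<in> {0..1}" for t
  proof -
    have "g j (1, t) = x" if "j \<noteq> 0" for j
      using that E01 v01[of _ t] by (cases j) (auto simp: g_def max_absorb1)
    then have "glue x g (1, t) = g 0 (1, t)" by (rule glue_eqI)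
    then show ?thesis by (simp add: g_def)
  qed
  have m0: "0 < m 0" "m 0 < 1" "?a 0 = 0"
    using am[of 0] a1[of 1] by (simp_all add: harmonic_lo_def)
  have ends: "glue x g (s, 0) = x" "glue x g (s, 1) = x" if "s \<in> {0..1}" for s
  proof -
    have "g n (s, 0) = x" for n
      using g_off_Suc[of "(s, 0)" _] that m0 m_mono[of 0] E01 stretch_left[of 0 "m 0" 0]
      by (cases n) (auto simp: g_def split: nat.splits intro: order_trans[OF less_imp_le])
    then show "glue x g (s, 0) = x" by (rule glue_eq_base)
    have "m n \<le> 1" for n using m_less[of n "Suc n"] a1[of "Suc n"] by simp
    then have "g n (s, 1) = x" for n
      using g_off[of "(s, 1)"] g_off_Suc[of "(s, 1)"] that by (cases n) auto
    then show "glue x g (s, 1) = x" by (rule glue_eq_base)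
  qed
  have "homotopic_paths X ?P (\<lambda>t. E 0 (stretch (?a 0) (m 0) t))"
    unfolding homotopic_paths
  proof (intro exI conjI ballI)
    show "continuous_on ?Z (glue x g)" by (rule continuous_on_glue[OF cont disj null])
    show "glue x g \<in> ?Z \<rightarrow> X"
    proof
      fix z :: "real \<times> real" assume z: "z \<in> ?Z"
      have "g n z \<in> X" for n
        using loops_at_in[OF El] stretch_01 v01 z
        by (cases n) (auto simp: g_def max_def)
      then show "glue x g z \<in> X" using x by (simp add: glue_def)
    qed
  qed (use start finish ends start[of 0] start[of 1] in \<open>auto simp: pathstart_def pathfinish_def\<close>)
  also have "homotopic_paths X (\<lambda>t. E 0 (stretch (?a 0) (m 0) t)) (E 0)"
  proof (rule homotopic_paths_sym, rule homotopic_paths_reparametrize)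
    show "continuous_on {0..1} (stretch (?a 0) (m 0))"
      unfolding stretch_def by (intro continuous_intros) (use am[of 0] in auto)
    show "stretch (?a 0) (m 0) \<in> {0..1} \<rightarrow> {0..1}" using stretch_01 by blast
    show "stretch (?a 0) (m 0) 0 = 0" "stretch (?a 0) (m 0) 1 = 1"
      using m0 by (auto intro: stretch_left stretch_right)
  qed (use El[of 0] in \<open>auto simp: loops_at_def\<close>)
  finally show ?thesis .
qed

section \<open>Self-similarity of products along the Cantor set\<close>
lemma iprod_cantor_eq:
  assumes e: "\<And>L. e L \<in> loops_at X x" and t: "t \<in> {gap_lo L..gap_hi L}"
  shows "iprod_cantor x e t = e L ((t - gap_lo L) / (gap_hi L - gap_lo L))"
  by (rule iprod_eq[where X = X]) (use e t gap_less gap_separated_le in blast)+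

lemma iprod_cantor_left:
  assumes e: "\<And>L. e L \<in> loops_at X x" and t: "t \<in> {0..1}"
  shows "iprod_cantor x e (t / 3) = iprod_cantor x (\<lambda>L. e (False # L)) t"
proof (cases "\<exists>L. t \<in> gap L")
  case True
  then obtain L where L: "t \<in> gap L" by blast
  have "iprod_cantor x e (t / 3)
      = e (False # L) ((t / 3 - gap_lo (False # L)) / (gap_hi (False # L) - gap_lo (False # L)))"
    by (rule iprod_cantor_eq[where X = X]) (use e L in auto)
  also have "(t / 3 - gap_lo (False # L)) / (gap_hi (False # L) - gap_lo (False # L))
      = (t - gap_lo L) / (gap_hi L - gap_lo L)"
  proof -
    have "t / 3 - gap_lo (False # L) = (t - gap_lo L) / 3"
      "gap_hi (False # L) - gap_lo (False # L) = (gap_hi L - gap_lo L) / 3"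
      by (simp_all add: diff_divide_distrib)
    then show ?thesis by (simp only: divide_divide_eq_left divide_divide_eq_right mult_divide_mult_cancel_right)
  qed
  also have "e (False # L) \<dots> = iprod_cantor x (\<lambda>L. e (False # L)) t"
    by (rule iprod_cantor_eq[where X = X and e = "\<lambda>L. e (False # L)", symmetric]) (use e L in auto)
  finally show ?thesis .
next
  case False
  have "t / 3 \<notin> gap M" for M
    using t False gap_bounds[of "tl M"] by (cases M) auto
  then have "iprod_cantor x e (t / 3) = x" by (intro iprod_base[OF e gap_less])
  moreover have "iprod_cantor x (\<lambda>L. e (False # L)) t = x"
    by (rule iprod_base[OF e gap_less]) (use False in blast)
  ultimately show ?thesis by simp
qed

lemma iprod_cantor_right:
  assumes e: "\<And>L. e L \<in> loops_at X x" and t: "t \<in> {0..1}"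
  shows "iprod_cantor x e ((t + 2) / 3) = iprod_cantor x (\<lambda>L. e (True # L)) t"
proof (cases "\<exists>L. t \<in> gap L")
  case True
  then obtain L where L: "t \<in> gap L" by blast
  have "iprod_cantor x e ((t + 2) / 3)
      = e (True # L) (((t + 2) / 3 - gap_lo (True # L)) / (gap_hi (True # L) - gap_lo (True # L)))"
    by (rule iprod_cantor_eq[where X = X]) (use e L in auto)
  also have "((t + 2) / 3 - gap_lo (True # L)) / (gap_hi (True # L) - gap_lo (True # L))
      = (t - gap_lo L) / (gap_hi L - gap_lo L)"
  proof -
    have "(t + 2) / 3 - gap_lo (True # L) = (t - gap_lo L) / 3"
      "gap_hi (True # L) - gap_lo (True # L) = (gap_hi L - gap_lo L) / 3"
      by (simp_all add: diff_divide_distrib add_divide_distrib)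
    then show ?thesis by (simp only: divide_divide_eq_left divide_divide_eq_right mult_divide_mult_cancel_right)
  qed
  also have "e (True # L) \<dots> = iprod_cantor x (\<lambda>L. e (True # L)) t"
    by (rule iprod_cantor_eq[where X = X and e = "\<lambda>L. e (True # L)", symmetric]) (use e L in auto)
  finally show ?thesis .
next
  case False
  have "(t + 2) / 3 \<notin> gap M" for M
    using t False gap_bounds[of "tl M"] by (cases M) auto
  then have "iprod_cantor x e ((t + 2) / 3) = x" by (intro iprod_base[OF e gap_less])
  moreover have "iprod_cantor x (\<lambda>L. e (True # L)) t = x"
    by (rule iprod_base[OF e gap_less]) (use False in blast)
  ultimately show ?thesis by simp
qed

lemma iprod_cantor_mid:
  assumes e: "\<And>L. e L \<in> loops_at X x" and t: "t \<in> {1/3..2/3}"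
  shows "iprod_cantor x e t = e [] (3 * t - 1)"
proof -
  have "iprod_cantor x e t = e [] ((t - gap_lo []) / (gap_hi [] - gap_lo []))"
    by (rule iprod_cantor_eq[where X = X]) (use e t in auto)
  then show ?thesis by (simp add: algebra_simps)
qed

text \<open>
  The three factors are the restrictions of the product to the thirds of the interval. The piecewise
  linear reparametrization is a maximum because it is convex: the concatenation spends half of the
  time on the first factor and a quarter on each of the other two.
\<close>
lemma iprod_cantor_split:
  assumes e: "null_loops X x e"
  shows "homotopic_paths X (iprod_cantor x e)
    (iprod_cantor x (\<lambda>L. e (False # L)) +++ e [] +++ iprod_cantor x (\<lambda>L. e (True # L)))"
proof (rule homotopic_paths_reparametrize[where f = "\<lambda>s. max (2 * s / 3) (4 * s / 3 - 1 / 3)"])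
  note el = null_loopsD(1)[OF e]
  show "path (iprod_cantor x e)" "path_image (iprod_cantor x e) \<subseteq> X"
    using iprod_cantor_loop[OF e] by (auto simp: loops_at_def)
  show "continuous_on {0..1} (\<lambda>s::real. max (2 * s / 3) (4 * s / 3 - 1 / 3))"
    by (intro continuous_intros) auto
  fix s :: real assume s: "s \<in> {0..1}"
  consider "s \<le> 1/2" | "1/2 < s" "s \<le> 3/4" | "3/4 < s" by linarith
  then show "(iprod_cantor x (\<lambda>L. e (False # L)) +++ e [] +++ iprod_cantor x (\<lambda>L. e (True # L))) s
      = iprod_cantor x e (max (2 * s / 3) (4 * s / 3 - 1 / 3))"
  proof cases
    case 1
    then have "max (2 * s / 3) (4 * s / 3 - 1 / 3) = (2 * s) / 3" by (simp add: max_def)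
    then show ?thesis using 1 s iprod_cantor_left[of e X x "2 * s", OF el] by (simp add: joinpaths_def)
  next
    case 2
    then have m: "max (2 * s / 3) (4 * s / 3 - 1 / 3) = 4 * s / 3 - 1 / 3" by (simp add: max_def)
    show ?thesis
      unfolding m using 2 iprod_cantor_mid[of e X x "4 * s / 3 - 1 / 3", OF el]
      by (simp add: joinpaths_def algebra_simps)
  next
    case 3
    then have m: "max (2 * s / 3) (4 * s / 3 - 1 / 3) = ((4 * s - 3) + 2) / 3" by (simp add: max_def field_simps)
    show ?thesis
      unfolding m using 3 s iprod_cantor_right[of e X x "4 * s - 3", OF el]
      by (simp add: joinpaths_def algebra_simps)
  qed
qed auto

lemma (in comm_group) mult_inv_cancel_right:
  assumes "a \<in> carrier G" "b \<in> carrier G" "c \<in> carrier G"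
  shows "a \<otimes> c \<otimes> inv (b \<otimes> c) = a \<otimes> inv b"
proof -
  have "c \<otimes> (inv c \<otimes> inv b) = inv b"
    using assms by (simp add: m_assoc[symmetric])
  then show ?thesis using assms by (simp add: inv_mult_group m_assoc)
qed

text \<open>
  The case of interest is the class, modulo \<open>N\<close>, of a loop conjugated by a path from the base point of the
  space to \<open>x\<close>. The commutativity of \<open>K\<close> is what the hypothesis on commutators provides.
\<close>
locale loop_invariant = comm_group K for K (structure) +
  fixes X :: "'a::topological_space set" and x :: 'a and q :: "(real \<Rightarrow> 'a) \<Rightarrow> 'k"
  constrains K :: "'k monoid"
  assumes closed: "p \<in> loops_at X x \<Longrightarrow> q p \<in> carrier K"
    and join: "p \<in> loops_at X x \<Longrightarrow> r \<in> loops_at X x \<Longrightarrow> q (p +++ r) = q p \<otimes> q r"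
    and reverse: "p \<in> loops_at X x \<Longrightarrow> q (reversepath p) = inv q p"
    and homotopic: "homotopic_paths X p r \<Longrightarrow> p \<in> loops_at X x \<Longrightarrow> q p = q r"

text \<open>
  The product, from left to right, of the loops that \<open>C\<close> assigns to the subfamilies below all words of
  length \<open>n\<close>. With \<open>C = iprod_cantor x\<close> it is what remains of the product along the Cantor set when all
  factors of level below \<open>n\<close> are deleted; with \<open>C e = e []\<close> it is the product of the factors of level
  exactly \<open>n\<close>.
\<close>
primrec level_prod ::
  "((bool list \<Rightarrow> real \<Rightarrow> 'a::topological_space) \<Rightarrow> real \<Rightarrow> 'a) \<Rightarrow> nat \<Rightarrow> (bool list \<Rightarrow> real \<Rightarrow> 'a) \<Rightarrow> real \<Rightarrow> 'a" where
  "level_prod C 0 e = C e"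
| "level_prod C (Suc n) e = level_prod C n (\<lambda>L. e (False # L)) +++ level_prod C n (\<lambda>L. e (True # L))"

lemma null_loops_Cons: "null_loops X x e \<Longrightarrow> null_loops X x (\<lambda>L. e (b # L))"
  by (rule null_loops_reindex) (auto simp: inj_def)

lemma level_prod_loop:
  assumes C: "\<And>e. null_loops X x e \<Longrightarrow> C e \<in> loops_at X x"
  shows "null_loops X x e \<Longrightarrow> level_prod C n e \<in> loops_at X x"
  by (induction n arbitrary: e) (auto intro!: C loops_at_join null_loops_Cons)

lemma level_prod_root_loop: "null_loops X x e \<Longrightarrow> level_prod (\<lambda>e. e []) n e \<in> loops_at X x"
  by (rule level_prod_loop) (rule null_loopsD(1))

lemma level_prod_cantor_loop: "null_loops X x e \<Longrightarrow> level_prod (iprod_cantor x) n e \<in> loops_at X x"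
  by (rule level_prod_loop) (rule iprod_cantor_loop)

lemma level_prod_image:
  assumes "\<And>L t. n \<le> length L \<Longrightarrow> t \<in> {0..1} \<Longrightarrow> e L t \<in> U" "x \<in> U" "t \<in> {0..1}"
  shows "level_prod (iprod_cantor x) n e t \<in> U"
  using assms
proof (induction n arbitrary: e t)
  case 0
  then show ?case by (auto intro!: iprod_image)
next
  case (Suc n)
  have "level_prod (iprod_cantor x) n (\<lambda>L. e (b # L)) s \<in> U" if "s \<in> {0..1}" for b s
    using Suc.prems that by (intro Suc.IH) auto
  then show ?case using Suc.prems(3) by (auto simp: joinpaths_def)
qed

text \<open>
  Deleting levels makes the product small: only finitely many members of the family leave a given
  neighbourhood of \<open>x\<close>, and they sit on finitely many levels.
\<close>
lemma null_loops_level_prod: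
  assumes e: "null_loops X x e"
  shows "null_loops X x (\<lambda>n. level_prod (iprod_cantor x) n e)"
proof -
  have "finite {n. \<not> level_prod (iprod_cantor x) n e ` {0..1} \<subseteq> U}" if U: "open U" "x \<in> U" for U
  proof -
    let ?F = "{L. \<not> e L ` {0..1} \<subseteq> U}"
    have F: "finite ?F" using null_loopsD(2)[OF e] U by (simp add: null_at_def)
    have "n \<in> (\<Union>L\<in>?F. {..length L})" if n: "\<not> level_prod (iprod_cantor x) n e ` {0..1} \<subseteq> U" for n
    proof (rule ccontr)
      assume "n \<notin> (\<Union>L\<in>?F. {..length L})"
      then have "e L t \<in> U" if "n \<le> length L" "t \<in> {0..1}" for L t using that by blast
      then have "level_prod (iprod_cantor x) n e t \<in> U" if "t \<in> {0..1}" for t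
        using level_prod_image[of n e U x t] U(2) that by blast
      then show False using n by blast
    qed
    then have "{n. \<not> level_prod (iprod_cantor x) n e ` {0..1} \<subseteq> U} \<subseteq> (\<Union>L\<in>?F. {..length L})" by blast
    moreover have "finite (\<Union>L\<in>?F. {..length L})" using F by blast
    ultimately show ?thesis by (rule finite_subset)
  qed
  then show ?thesis
    using level_prod_cantor_loop[OF e] by (simp add: null_loops_def null_at_def)
qed

context loop_invariant
begin

lemma q_level_root:
  assumes "null_loops X x e" "null_loops X x d" "\<And>L. q (e L) = q (d L)"
  shows "q (level_prod (\<lambda>e. e []) n e) = q (level_prod (\<lambda>e. e []) n d)"
  using assms
proof (induction n arbitrary: e d)
  case (Suc n)
  have "level_prod (\<lambda>e. e []) n (\<lambda>L. c (b # L)) \<in> loops_at X x" if "null_loops X x c" for c b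
    by (intro level_prod_root_loop null_loops_Cons that)
  then show ?case
    using Suc.IH[of "\<lambda>L. e (_ # L)" "\<lambda>L. d (_ # L)"] Suc.prems
    by (simp add: join null_loops_Cons)
qed simp

text \<open>
  For each word of length \<open>n\<close> the self-similar product splits off the factor at that word. As the
  values of \<open>q\<close> commute, these factors can be collected.
\<close>
lemma q_level_cantor:
  assumes "null_loops X x e"
  shows "q (level_prod (iprod_cantor x) n e)
    = q (level_prod (iprod_cantor x) (Suc n) e) \<otimes> q (level_prod (\<lambda>e. e []) n e)"
  using assms
proof (induction n arbitrary: e)
  case 0
  note l = null_loopsD(1)[OF 0] iprod_cantor_loop[OF null_loops_Cons[OF 0]]
  have "q (iprod_cantor x e) = q (iprod_cantor x (\<lambda>L. e (False # L)) +++ e [] +++ iprod_cantor x (\<lambda>L. e (True # L)))"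
    by (rule homotopic[OF iprod_cantor_split[OF 0] iprod_cantor_loop[OF 0]])
  then show ?case
    using l by (simp add: join closed loops_at_join m_ac)
next
  case (Suc n)
  have l: "level_prod (\<lambda>e. e []) n (\<lambda>L. e (b # L)) \<in> loops_at X x"
    "level_prod (iprod_cantor x) m (\<lambda>L. e (b # L)) \<in> loops_at X x" for b m
    by (intro level_prod_root_loop level_prod_cantor_loop null_loops_Cons Suc.prems)+
  have "q (level_prod (iprod_cantor x) (Suc n) e)
      = q (level_prod (iprod_cantor x) n (\<lambda>L. e (False # L))) \<otimes> q (level_prod (iprod_cantor x) n (\<lambda>L. e (True # L)))"
    by (simp add: join l)
  also have "\<dots> = (q (level_prod (iprod_cantor x) (Suc n) (\<lambda>L. e (False # L))) \<otimes> q (level_prod (\<lambda>e. e []) n (\<lambda>L. e (False # L))))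
      \<otimes> (q (level_prod (iprod_cantor x) (Suc n) (\<lambda>L. e (True # L))) \<otimes> q (level_prod (\<lambda>e. e []) n (\<lambda>L. e (True # L))))"
    by (rule arg_cong2[where f = "(\<otimes>)", OF Suc.IH[OF null_loops_Cons[OF Suc.prems]]
          Suc.IH[OF null_loops_Cons[OF Suc.prems]]])
  also have "\<dots> = (q (level_prod (iprod_cantor x) (Suc n) (\<lambda>L. e (False # L))) \<otimes> q (level_prod (iprod_cantor x) (Suc n) (\<lambda>L. e (True # L))))
      \<otimes> (q (level_prod (\<lambda>e. e []) n (\<lambda>L. e (False # L))) \<otimes> q (level_prod (\<lambda>e. e []) n (\<lambda>L. e (True # L))))"
    using closed[OF l(1)] closed[OF l(2)] by (simp only: m_ac m_closed)
  also have "\<dots> = q (level_prod (iprod_cantor x) (Suc (Suc n)) e) \<otimes> q (level_prod (\<lambda>e. e []) (Suc n) e)"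
    by (simp only: level_prod.simps(2)[of _ "Suc n" e] level_prod.simps(2)[of "\<lambda>e. e []" n e] join[OF l(1) l(1)] join[OF l(2) l(2)])
  finally show ?case .
qed

text \<open>
  This is where sequential products control products along the Cantor set. Deleting the levels below
  \<open>n\<close> from both products changes them by factors with equal invariants, so the quotients \<open>E n\<close> of what
  remains all have the same value under \<open>q\<close>. They form a null family, so the hypothesis applies to the
  loops \<open>E n +++ reversepath (E (Suc n))\<close>, and their product telescopes to \<open>E 0\<close>.
\<close>
lemma cantor_pair_trivial:
  assumes seq: "\<And>E. null_loops X x E \<Longrightarrow> (\<And>n. q (E n) = \<one>) \<Longrightarrow> q (iprod_seq x E) = \<one>"
    and e: "null_loops X x e" and d: "null_loops X x d" and ed: "\<And>L. q (e L) = q (d L)"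
  shows "q (iprod_cantor x e +++ reversepath (iprod_cantor x d)) = \<one>"
proof -
  define E where "E = (\<lambda>n. level_prod (iprod_cantor x) n e +++ reversepath (level_prod (iprod_cantor x) n d))"
  have nE: "null_loops X x E"
    unfolding E_def by (intro null_loops_join null_loops_reverse null_loops_level_prod e d)
  have l: "level_prod (iprod_cantor x) n e \<in> loops_at X x" "level_prod (iprod_cantor x) n d \<in> loops_at X x" for n
    by (intro level_prod_cantor_loop e d)+
  have r: "level_prod (\<lambda>e. e []) n e \<in> loops_at X x" for n
    by (intro level_prod_root_loop e)
  have qE: "q (E n) = q (level_prod (iprod_cantor x) n e) \<otimes> inv q (level_prod (iprod_cantor x) n d)" for n
    unfolding E_def by (simp add: join reverse l loops_at_reverse)
  have "q (E n) = q (E (Suc n))" for n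
  proof -
    let ?a = "q (level_prod (iprod_cantor x) (Suc n) e)" and ?b = "q (level_prod (iprod_cantor x) (Suc n) d)"
      and ?c = "q (level_prod (\<lambda>e. e []) n e)"
    have c: "?a \<in> carrier K" "?b \<in> carrier K" "?c \<in> carrier K" using closed l r by blast+
    have "q (E n) = (?a \<otimes> ?c) \<otimes> inv (?b \<otimes> ?c)"
      unfolding qE q_level_cantor[OF e, of n] q_level_cantor[OF d, of n]
        q_level_root[OF e d ed] by (rule refl)
    also have "\<dots> = ?a \<otimes> inv ?b" by (rule mult_inv_cancel_right[OF c])
    also have "\<dots> = q (E (Suc n))" unfolding qE ..
    finally show ?thesis .
  qed
  then have "q (E n +++ reversepath (E (Suc n))) = \<one>" for n
    using null_loopsD(1)[OF nE] by (simp add: join reverse closed loops_at_reverse)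
  moreover have nP: "null_loops X x (\<lambda>n. E n +++ reversepath (E (Suc n)))"
    using null_loops_reindex[OF nE, of Suc] by (intro null_loops_join null_loops_reverse nE) auto
  ultimately have "q (iprod_seq x (\<lambda>n. E n +++ reversepath (E (Suc n)))) = \<one>" by (intro seq)
  then have "q (E 0) = \<one>"
    using homotopic[OF telescoping_homotopy[OF nE] iprod_seq_loop[OF nP]] by simp
  then show ?thesis by (simp add: E_def)
qed

end

section \<open>The three notions of closedness\<close>
lemma (in whisker_path) loop_invariant_quotient:
  assumes K: "comm_group K" and \<phi>: "\<phi> \<in> hom (pi1 X x0) K"
  shows "loop_invariant K X x1 (\<lambda>p. \<phi> (whiskered X \<alpha> p))"
proof -
  interpret group_hom "pi1 X x0" K \<phi>
    by (intro group_hom.intro group_pi1 x0_in comm_group.axioms(2)[OF K] group_hom_axioms.intro \<phi>)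
  show ?thesis
    by (intro loop_invariant.intro loop_invariant_axioms.intro K)
       (auto simp: whiskered_in_carrier whiskered_join whiskered_reverse
         dest: whiskered_homotopic)
qed

lemma (in whisker_path) whiskered_join3:
  assumes "p \<in> loops_at X x1" "r \<in> loops_at X x1"
  shows "hclass X (\<alpha> +++ p +++ r +++ reversepath \<alpha>) = whiskered X \<alpha> (p +++ r)"
  unfolding whiskered_def using assms path image start finish
  by (intro hclass_eqI homotopic_paths_join homotopic_paths_assoc)
     (auto simp: loops_at_def path_image_join)

lemma compose_ell:
  assumes "\<And>i t. t \<in> {0..1} \<Longrightarrow> f (ell (Suc i) t) = e i t" "1 \<le> n" "t \<in> {0..1}"
  shows "f (ell n t) = e (n - 1) t"
  using assms(1)[OF assms(3), of "n - 1"] assms(2) by simp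

text \<open>
  The loops \<open>ell n\<close> are numbered from 1 and the members of the family from 0, whence the shift by 1 here
  and below.
\<close>
lemma compose_iprod_ell:
  assumes f: "f b0 = x" "\<And>i t. t \<in> {0..1} \<Longrightarrow> f (ell (Suc i) t) = e i t"
    and \<psi>: "\<And>i. 1 \<le> \<psi> i"
    and ab: "\<And>i. a i < b i" "\<And>i j. i \<noteq> j \<Longrightarrow> b i \<le> a j \<or> b j \<le> a i"
  shows "f (iprod b0 a b (\<lambda>i. ell (\<psi> i)) t) = iprod x a b (\<lambda>i. e (\<psi> i - 1)) t"
proof (rule iprod_compose[where X = earring])
  show "f (ell (\<psi> j) s) = e (\<psi> j - 1) s" if "s \<in> {0..1}" for j s
    using f(2)[OF that, of "\<psi> j - 1"] \<psi>[of j] by simp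
qed (use f ab ell_loop \<psi> in auto)

lemma ell_map_ell_tau:
  assumes "\<And>n. 1 \<le> n \<Longrightarrow> 1 \<le> \<phi> n" "t \<in> {0..1}"
  shows "ell_map \<phi> (ell_tau t) = iprod_cantor b0 (\<lambda>L. ell (\<phi> (node L))) t"
  unfolding ell_tau_eq[OF assms(2)]
  by (rule iprod_compose[where X = earring])
     (use ell_loop node_pos gap_less gap_separated_le ell_map_ell ell_map_b0 in auto)

lemma c_elt_eq: "c_elt = (\<lambda>n. whiskered earring_plus whisker (ell n))"
  by (simp add: fun_eq_iff c_elt_def whiskered_def)

lemma tg_closed_c_inf_iff:
  assumes N: "subgroup N (pi1 X x0)"
  shows "tg_closed earring_plus b0_plus c_subgroup c_inf X x0 N \<longleftrightarrow>
    (\<forall>x1 \<alpha> e. whisker_path X x0 x1 \<alpha> \<and> null_loops X x1 e \<and> (\<forall>n\<ge>1. whiskered X \<alpha> (e (n - 1)) \<in> N)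
      \<longrightarrow> whiskered X \<alpha> (iprod_seq x1 e) \<in> N)"
proof -
  have c: "c_inf = whiskered earring_plus whisker ell_inf" by (simp add: c_inf_def whiskered_def)
  have iprod: "f (ell_inf t) = iprod_seq x1 e t"
    if "f b0 = x1" "\<And>i t. t \<in> {0..1} \<Longrightarrow> f (ell (Suc i) t) = e i t" "t \<in> {0..1}" for f x1 e t
    unfolding ell_inf_eq[OF that(3)]
    using compose_iprod_ell[where \<psi> = Suc and a = harmonic_lo and b = harmonic_hi, OF that(1,2)]
      harmonic_bounds(2) harmonic_separated by simp
  show ?thesis
    unfolding c c_subgroup_def c_elt_eq
  proof (rule tg_closed_earring_iff[OF N ell_loop ell_inf_loop])
    fix f :: "real \<times> real \<Rightarrow> 'a" and x1 and e :: "nat \<Rightarrow> real \<Rightarrow> 'a" and n and t :: real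
    assume f: "f b0 = x1" "\<And>i t. t \<in> {0..1} \<Longrightarrow> f (ell (Suc i) t) = e i t" and t: "t \<in> {0..1}"
    show "(1 \<le> n \<longrightarrow> f (ell n t) = e (n - 1) t) \<and> f (ell_inf t) = iprod_seq x1 e t"
      using iprod[OF f t] compose_ell[of f e n t, OF f(2) _ t] by blast
  qed
qed

lemma tg_closed_c_tau_iff:
  assumes N: "subgroup N (pi1 X x0)"
  shows "tg_closed earring_plus b0_plus c_subgroup c_tau X x0 N \<longleftrightarrow>
    (\<forall>x1 \<alpha> e. whisker_path X x0 x1 \<alpha> \<and> null_loops X x1 e \<and> (\<forall>n\<ge>1. whiskered X \<alpha> (e (n - 1)) \<in> N)
      \<longrightarrow> whiskered X \<alpha> (iprod_cantor x1 (\<lambda>L. e (node L - 1))) \<in> N)"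
proof -
  have c: "c_tau = whiskered earring_plus whisker ell_tau" by (simp add: c_tau_def whiskered_def)
  have iprod: "f (ell_tau t) = iprod_cantor x1 (\<lambda>L. e (node L - 1)) t"
    if "f b0 = x1" "\<And>i t. t \<in> {0..1} \<Longrightarrow> f (ell (Suc i) t) = e i t" "t \<in> {0..1}" for f x1 e t
    unfolding ell_tau_eq[OF that(3)]
    by (rule compose_iprod_ell[where \<psi> = node, OF that(1,2) node_pos gap_less gap_separated_le])
  show ?thesis
    unfolding c c_subgroup_def c_elt_eq
  proof (rule tg_closed_earring_iff[OF N ell_loop ell_tau_loop])
    fix f :: "real \<times> real \<Rightarrow> 'a" and x1 and e :: "nat \<Rightarrow> real \<Rightarrow> 'a" and n and t :: real
    assume f: "f b0 = x1" "\<And>i t. t \<in> {0..1} \<Longrightarrow> f (ell (Suc i) t) = e i t" and t: "t \<in> {0..1}"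
    show "(1 \<le> n \<longrightarrow> f (ell n t) = e (n - 1) t) \<and> f (ell_tau t) = iprod_cantor x1 (\<lambda>L. e (node L - 1)) t"
      using iprod[OF f t] compose_ell[of f e n t, OF f(2) _ t] by blast
  qed
qed

lemma ell_map_ell_tau_loop:
  assumes "\<And>n. 1 \<le> n \<Longrightarrow> 1 \<le> \<phi> n" "inj (\<lambda>L. \<phi> (node L))"
  shows "ell_map \<phi> \<circ> ell_tau \<in> loops_at earring b0"
proof (rule loops_at_cong)
  show "iprod_cantor b0 (\<lambda>L. ell (\<phi> (node L))) \<in> loops_at earring b0"
    using assms node_pos by (intro iprod_cantor_loop null_loops_ell) auto
qed (use ell_map_ell_tau[OF assms(1)] in auto)

lemma tg_closed_p_tau_iff:
  assumes N: "subgroup N (pi1 X x0)"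
  shows "tg_closed earring_plus b0_plus p_subgroup p_tau X x0 N \<longleftrightarrow>
    (\<forall>x1 \<alpha> e. whisker_path X x0 x1 \<alpha> \<and> null_loops X x1 e
        \<and> (\<forall>n\<ge>1. whiskered X \<alpha> (e (2 * n - 1 - 1) +++ reversepath (e (2 * n - 1))) \<in> N)
      \<longrightarrow> whiskered X \<alpha> (iprod_cantor x1 (\<lambda>L. e (2 * node L - 1 - 1))
            +++ reversepath (iprod_cantor x1 (\<lambda>L. e (2 * node L - 1)))) \<in> N)"
proof -
  interpret w: whisker_path earring_plus b0_plus b0 whisker by (rule whisker_path_whisker)
  have odd: "f_odd \<circ> ell_tau \<in> loops_at earring b0" and even: "f_even \<circ> ell_tau \<in> loops_at earring b0"
    unfolding f_odd_def f_even_def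
    by (rule ell_map_ell_tau_loop; use inj_node node_pos in \<open>fastforce simp: inj_def\<close>)+
  let ?g = "\<lambda>n. ell (2 * n - 1) +++ reversepath (ell (2 * n))"
  let ?g' = "(f_odd \<circ> ell_tau) +++ reversepath (f_even \<circ> ell_tau)"
  have loops: "p \<in> loops_at earring_plus b0" if "p \<in> loops_at earring b0" for p
    by (rule loops_at_mono[OF that earring_subset_plus])
  have p: "p_tau = whiskered earring_plus whisker ?g'"
    unfolding p_tau_def by (intro w.whiskered_join3 loops_at_reverse loops odd even)
  have pn: "p_elt n = whiskered earring_plus whisker (?g n)" if "1 \<le> n" for n
    unfolding p_elt_def using that by (intro w.whiskered_join3 loops_at_reverse loops ell_loop) auto
  have P: "p_subgroup = generate (pi1 earring_plus b0_plus) ((\<lambda>n. whiskered earring_plus whisker (?g n)) ` {1..})"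
    unfolding p_subgroup_def using pn by (intro arg_cong2[where f = generate] image_cong) auto
  have iprod: "f (f_odd (ell_tau t)) = iprod_cantor x1 (\<lambda>L. e (2 * node L - 1 - 1)) t"
      "f (f_even (ell_tau t)) = iprod_cantor x1 (\<lambda>L. e (2 * node L - 1)) t"
    if f: "f b0 = x1" "\<And>i t. t \<in> {0..1} \<Longrightarrow> f (ell (Suc i) t) = e i t" "t \<in> {0..1}" for f x1 and e :: "nat \<Rightarrow> real \<Rightarrow> 'a" and t
  proof -
    have n: "1 \<le> 2 * node L - 1" "1 \<le> 2 * node L" for L using node_pos[of L] by simp_all
    have "f_odd (ell_tau t) = iprod_cantor b0 (\<lambda>L. ell (2 * node L - 1)) t"
      unfolding f_odd_def by (rule ell_map_ell_tau[OF _ f(3)]) simp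
    then show "f (f_odd (ell_tau t)) = iprod_cantor x1 (\<lambda>L. e (2 * node L - 1 - 1)) t"
      using compose_iprod_ell[where \<psi> = "\<lambda>L. 2 * node L - 1", OF f(1,2) n(1) gap_less gap_separated_le] by simp
    have "f_even (ell_tau t) = iprod_cantor b0 (\<lambda>L. ell (2 * node L)) t"
      unfolding f_even_def by (rule ell_map_ell_tau[OF _ f(3)]) simp
    then show "f (f_even (ell_tau t)) = iprod_cantor x1 (\<lambda>L. e (2 * node L - 1)) t"
      using compose_iprod_ell[where \<psi> = "\<lambda>L. 2 * node L", OF f(1,2) n(2) gap_less gap_separated_le] by simp
  qed
  show ?thesis
    unfolding p P
  proof (rule tg_closed_earring_iff[OF N])
    show "?g n \<in> loops_at earring b0" if "1 \<le> n" for n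
      using that by (intro loops_at_join loops_at_reverse ell_loop) auto
    show "?g' \<in> loops_at earring b0"
      by (intro loops_at_join loops_at_reverse odd even)
    fix f :: "real \<times> real \<Rightarrow> 'a" and x1 and e :: "nat \<Rightarrow> real \<Rightarrow> 'a" and n and t :: real
    assume f: "f b0 = x1" "\<And>i t. t \<in> {0..1} \<Longrightarrow> f (ell (Suc i) t) = e i t" and t: "t \<in> {0..1}"
    have *: "f ((p +++ reversepath r) t) = (p' +++ reversepath r') t"
      if "\<And>s. s \<in> {0..1} \<Longrightarrow> f (p s) = p' s" "\<And>s. s \<in> {0..1} \<Longrightarrow> f (r s) = r' s" for p r p' r'
      using that t by (auto simp: joinpaths_def reversepath_def)
    have "f (?g n t) = (e (2 * n - 1 - 1) +++ reversepath (e (2 * n - 1))) t" if "1 \<le> n"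
      using that by (intro * compose_ell[of f e, OF f(2)]) auto
    moreover have "f (?g' t) = (iprod_cantor x1 (\<lambda>L. e (2 * node L - 1 - 1))
            +++ reversepath (iprod_cantor x1 (\<lambda>L. e (2 * node L - 1)))) t"
      by (rule *) (simp_all only: o_apply iprod[OF f])
    ultimately show "(1 \<le> n \<longrightarrow> f (?g n t) = (e (2 * n - 1 - 1) +++ reversepath (e (2 * n - 1))) t) \<and>
        f (?g' t) = (iprod_cantor x1 (\<lambda>L. e (2 * node L - 1 - 1))
            +++ reversepath (iprod_cantor x1 (\<lambda>L. e (2 * node L - 1)))) t" by blast
  qed
qed

text \<open>
  The rightmost gaps of the successive levels form a sequence ordered like the intervals of
  \<open>ell_inf\<close>, so a product along the Cantor set can imitate a sequential one.
\<close>
lemma gap_rightmost: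
  "gap_lo (replicate j True) = 1 - 2 / 3 ^ Suc j" "gap_hi (replicate j True) = 1 - 1 / 3 ^ Suc j"
  by (induction j) (simp_all add: field_simps)

lemma rightmost_gaps_ordered: "i < j \<Longrightarrow> gap_hi (replicate i True) \<le> gap_lo (replicate j True)"
proof -
  assume "i < j"
  then have "(3::real) ^ Suc (Suc i) \<le> 3 ^ Suc j" by (intro power_increasing) auto
  then have "2 / 3 ^ Suc j \<le> (2::real) / 3 ^ Suc (Suc i)" by (intro divide_left_mono) auto
  also have "\<dots> \<le> 1 / 3 ^ Suc i" by (simp add: field_simps)
  finally show ?thesis by (simp only: gap_rightmost)
qed

lemma iprod_const: "iprod x a b (\<lambda>_ _. x) = (\<lambda>_. x)"
  by (simp add: iprod_def glue_def fun_eq_iff)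

theorem proposition3p22:
  fixes X :: "'a::topological_space set" and x0 :: 'a and N :: "(real \<Rightarrow> 'a) set set"
  assumes "path_connected X" and "x0 \<in> X"
    and "subgroup N (pi1 X x0)"
    and "derived (pi1 X x0) (carrier (pi1 X x0)) \<subseteq> N"
  shows "(tg_closed earring_plus b0_plus c_subgroup c_inf X x0 N \<longleftrightarrow>
          tg_closed earring_plus b0_plus c_subgroup c_tau X x0 N) \<and>
         (tg_closed earring_plus b0_plus c_subgroup c_tau X x0 N \<longleftrightarrow>
          tg_closed earring_plus b0_plus p_subgroup p_tau X x0 N)"
proof -
  note N = assms(3)
  interpret G: group "pi1 X x0" by (rule group_pi1[OF assms(2)])
  have inf_to_pair: "tg_closed earring_plus b0_plus p_subgroup p_tau X x0 N"
    if inf: "tg_closed earring_plus b0_plus c_subgroup c_inf X x0 N"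
    unfolding tg_closed_p_tau_iff[OF N]
  proof (intro allI impI, elim conjE)
    fix x1 \<alpha> and e :: "nat \<Rightarrow> real \<Rightarrow> 'a"
    assume \<alpha>: "whisker_path X x0 x1 \<alpha>" and e: "null_loops X x1 e"
      and eN: "\<forall>n\<ge>1. whiskered X \<alpha> (e (2 * n - 1 - 1) +++ reversepath (e (2 * n - 1))) \<in> N"
    interpret whisker_path X x0 x1 \<alpha> by (rule \<alpha>)
    obtain K :: "(real \<Rightarrow> 'a) set set monoid" and \<phi> where K: "comm_group K"
      and \<phi>: "\<phi> \<in> hom (pi1 X x0) K"
      and ker: "\<And>g. g \<in> carrier (pi1 X x0) \<Longrightarrow> \<phi> g = \<one>\<^bsub>K\<^esub> \<longleftrightarrow> g \<in> N"
      using G.abelian_quotient[OF N assms(4)] by blast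
    \<comment> \<open>Membership in \<open>N\<close> becomes triviality of an invariant with values in the abelian quotient.\<close>
    define q where "q = (\<lambda>p. \<phi> (whiskered X \<alpha> p))"
    interpret q: loop_invariant K X x1 q
      unfolding q_def by (rule loop_invariant_quotient[OF K \<phi>])
    have q_one: "q p = \<one>\<^bsub>K\<^esub> \<longleftrightarrow> whiskered X \<alpha> p \<in> N" if "p \<in> loops_at X x1" for p
      unfolding q_def by (rule ker[OF whiskered_in_carrier[OF that]])
    let ?a = "\<lambda>L. e (2 * node L - 1 - 1)" and ?b = "\<lambda>L. e (2 * node L - 1)"
    have inj: "inj (\<lambda>L. 2 * node L - 1 - 1)" "inj (\<lambda>L. 2 * node L - 1)"
    proof -
      have "L = M" if "2 * node L - 1 - 1 = 2 * node M - 1 - 1 \<or> 2 * node L - 1 = 2 * node M - 1" for L M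
      proof -
        have "node L = node M" using that node_pos[of L] node_pos[of M] by linarith
        then show ?thesis using inj_node by (simp add: inj_def)
      qed
      then show "inj (\<lambda>L. 2 * node L - 1 - 1)" "inj (\<lambda>L. 2 * node L - 1)" by (simp_all add: inj_def)
    qed
    note a = null_loops_reindex[OF e inj(1)] and b = null_loops_reindex[OF e inj(2)]
    have "q (?a L) = q (?b L)" for L
    proof -
      have l: "?a L \<in> loops_at X x1" "?b L \<in> loops_at X x1" by (rule null_loopsD(1)[OF e])+
      have "q (?a L +++ reversepath (?b L)) = \<one>\<^bsub>K\<^esub>"
        using eN node_pos[of L] q_one loops_at_join[OF l(1) loops_at_reverse[OF l(2)]] by blast
      then have "q (?a L) \<otimes>\<^bsub>K\<^esub> inv\<^bsub>K\<^esub> q (?b L) = \<one>\<^bsub>K\<^esub>"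
        using q.join[OF l(1) loops_at_reverse[OF l(2)]] q.reverse[OF l(2)] by simp
      then show ?thesis using q.closed[OF l(1)] q.closed[OF l(2)] q.inv_solve_right'
        by (metis q.inv_equality q.inv_inv q.inv_closed)
    qed
    moreover have "q (iprod_seq x1 E) = \<one>\<^bsub>K\<^esub>"
      if E: "null_loops X x1 E" "\<And>n. q (E n) = \<one>\<^bsub>K\<^esub>" for E
    proof -
      have "\<forall>n\<ge>1. whiskered X \<alpha> (E (n - 1)) \<in> N"
        using E(2) q_one[OF null_loopsD(1)[OF E(1)]] by blast
      then have "whiskered X \<alpha> (iprod_seq x1 E) \<in> N"
        using inf \<alpha> E(1) unfolding tg_closed_c_inf_iff[OF N] by blast
      then show ?thesis using q_one[OF iprod_seq_loop[OF E(1)]] by blast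
    qed
    ultimately have "q (iprod_cantor x1 ?a +++ reversepath (iprod_cantor x1 ?b)) = \<one>\<^bsub>K\<^esub>"
      using q.cantor_pair_trivial[OF _ a b] by blast
    then show "whiskered X \<alpha> (iprod_cantor x1 ?a +++ reversepath (iprod_cantor x1 ?b)) \<in> N"
      using q_one[OF loops_at_join[OF iprod_cantor_loop[OF a] loops_at_reverse[OF iprod_cantor_loop[OF b]]]]
      by blast
  qed
  have pair_to_tau: "tg_closed earring_plus b0_plus c_subgroup c_tau X x0 N"
    if pair: "tg_closed earring_plus b0_plus p_subgroup p_tau X x0 N"
    unfolding tg_closed_c_tau_iff[OF N]
  proof (intro allI impI, elim conjE)
    fix x1 \<alpha> and e :: "nat \<Rightarrow> real \<Rightarrow> 'a"
    assume \<alpha>: "whisker_path X x0 x1 \<alpha>" and e: "null_loops X x1 e"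
      and eN: "\<forall>n\<ge>1. whiskered X \<alpha> (e (n - 1)) \<in> N"
    interpret whisker_path X x0 x1 \<alpha> by (rule \<alpha>)
    \<comment> \<open>The first loops of the pairs are the given ones, the second loops are constant.\<close>
    define e' where "e' = spread x1 (\<lambda>n. 2 * n) e"
    have inj: "inj (\<lambda>n::nat. 2 * n)" by (simp add: inj_def)
    have e'_even: "e' (2 * n - 1 - 1) = e (n - 1)" if "1 \<le> n" for n
    proof -
      have "2 * n - 1 - 1 = 2 * (n - 1)" using that by simp
      then show ?thesis unfolding e'_def by (simp only: spread_range[OF inj])
    qed
    have e'_odd: "e' (2 * n - 1) = (\<lambda>_. x1)" if "1 \<le> n" for n
      unfolding e'_def using that by (intro spread_const) (auto, presburger)
    have unpair: "whiskered X \<alpha> (p +++ reversepath (\<lambda>_. x1)) = whiskered X \<alpha> p" if p: "p \<in> loops_at X x1" for p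
    proof -
      have "reversepath (\<lambda>_::real. x1) = (\<lambda>_. x1)" by (simp add: reversepath_def)
      then show ?thesis
        using whiskered_join[OF p loops_at_const[OF x1_in]] whiskered_in_carrier[OF p] by (simp add: whiskered_const)
    qed
    have "null_loops X x1 e'" unfolding e'_def by (rule null_loops_spread[OF e x1_in inj])
    moreover have "\<forall>n\<ge>1. whiskered X \<alpha> (e' (2 * n - 1 - 1) +++ reversepath (e' (2 * n - 1))) \<in> N"
    proof (intro allI impI)
      fix n :: nat assume n: "1 \<le> n"
      show "whiskered X \<alpha> (e' (2 * n - 1 - 1) +++ reversepath (e' (2 * n - 1))) \<in> N"
        unfolding e'_even[OF n] e'_odd[OF n] unpair[OF null_loopsD(1)[OF e]] using eN n by blast
    qed
    ultimately have "whiskered X \<alpha> (iprod_cantor x1 (\<lambda>L. e' (2 * node L - 1 - 1))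
            +++ reversepath (iprod_cantor x1 (\<lambda>L. e' (2 * node L - 1)))) \<in> N"
      using pair \<alpha> unfolding tg_closed_p_tau_iff[OF N] by blast
    moreover have "inj (\<lambda>L. node L - 1)"
    proof (rule injI)
      fix L M assume "node L - 1 = node M - 1"
      then have "node L = node M" using node_pos[of L] node_pos[of M] by linarith
      then show "L = M" using inj_node by (simp add: inj_def)
    qed
    then have "iprod_cantor x1 (\<lambda>L. e (node L - 1)) \<in> loops_at X x1"
      by (intro iprod_cantor_loop null_loops_reindex[OF e])
    ultimately show "whiskered X \<alpha> (iprod_cantor x1 (\<lambda>L. e (node L - 1))) \<in> N"
      by (simp only: e'_even[OF node_pos] e'_odd[OF node_pos] iprod_const unpair)
  qed
  have tau_to_inf: "tg_closed earring_plus b0_plus c_subgroup c_inf X x0 N"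
    if tau: "tg_closed earring_plus b0_plus c_subgroup c_tau X x0 N"
    unfolding tg_closed_c_inf_iff[OF N]
  proof (intro allI impI, elim conjE)
    fix x1 \<alpha> and e :: "nat \<Rightarrow> real \<Rightarrow> 'a"
    assume \<alpha>: "whisker_path X x0 x1 \<alpha>" and e: "null_loops X x1 e"
      and eN: "\<forall>n\<ge>1. whiskered X \<alpha> (e (n - 1)) \<in> N"
    interpret whisker_path X x0 x1 \<alpha> by (rule \<alpha>)
    \<comment> \<open>The \<open>j\<close>-th loop is placed in the rightmost gap \<open>r j\<close> of its level; all other gaps get constant loops.\<close>
    define r where "r = (\<lambda>j. replicate j True)"
    define \<psi> where "\<psi> = (\<lambda>j. node (r j) - 1)"
    have inj_r: "inj r" by (rule injI) (metis length_replicate r_def)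
    have node_eq: "L = M" if "node L - 1 = node M - 1" for L M
    proof -
      have "node L = node M" using that node_pos[of L] node_pos[of M] by linarith
      then show ?thesis using inj_node by (simp add: inj_def)
    qed
    have inj_\<psi>: "inj \<psi>"
    proof (rule injI)
      fix i j assume "\<psi> i = \<psi> j"
      then have "r i = r j" unfolding \<psi>_def by (rule node_eq)
      then show "i = j" by (rule injD[OF inj_r])
    qed
    define e' where "e' = spread x1 \<psi> e"
    have "null_loops X x1 e'" unfolding e'_def by (rule null_loops_spread[OF e x1_in inj_\<psi>])
    moreover have "whiskered X \<alpha> (e' n) \<in> N" for n
    proof (cases "n \<in> range \<psi>")
      case True
      then obtain j where "n = \<psi> j" by blast
      then have "e' n = e (Suc j - 1)" by (simp add: e'_def spread_range[OF inj_\<psi>])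
      then show ?thesis using eN[rule_format, of "Suc j"] by simp
    next
      case False
      then show ?thesis
        using subgroup.one_closed[OF N] by (simp add: e'_def spread_const whiskered_const)
    qed
    ultimately have "whiskered X \<alpha> (iprod_cantor x1 (\<lambda>L. e' (node L - 1))) \<in> N"
      using tau \<alpha> unfolding tg_closed_c_tau_iff[OF N] by blast
    moreover have "(\<lambda>L. e' (node L - 1)) = spread x1 r e"
    proof
      fix L
      show "e' (node L - 1) = spread x1 r e L"
      proof (cases "L \<in> range r")
        case True
        then obtain j where j: "L = r j" by blast
        then have "e' (node L - 1) = e' (\<psi> j)" by (simp add: \<psi>_def)
        then show ?thesis using j by (simp add: e'_def spread_range inj_\<psi> inj_r)
      next
        case False
        have "node L - 1 \<notin> range \<psi>"
        proof
          assume "node L - 1 \<in> range \<psi>"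
          then obtain j where "node L - 1 = node (r j) - 1" unfolding \<psi>_def by blast
          then show False using False node_eq[of L "r j"] by blast
        qed
        then show ?thesis using False by (simp add: e'_def spread_const)
      qed
    qed
    moreover have "iprod_cantor x1 (spread x1 r e) = iprod x1 (\<lambda>j. gap_lo (r j)) (\<lambda>j. gap_hi (r j)) e"
      using iprod_spread[OF null_loopsD(1)[OF e] inj_r gap_less gap_separated_le] by (intro ext)
    moreover have "homotopic_paths X (iprod_seq x1 e) (iprod x1 (\<lambda>j. gap_lo (r j)) (\<lambda>j. gap_hi (r j)) e)"
    proof (rule homotopic_iprod[OF e x1_in])
      fix i j :: nat assume "i \<noteq> j"
      then show "harmonic_hi i \<le> harmonic_lo j \<and> gap_hi (r i) \<le> gap_lo (r j) \<or>
          harmonic_hi j \<le> harmonic_lo i \<and> gap_hi (r j) \<le> gap_lo (r i)"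
        using harmonic_ordered rightmost_gaps_ordered unfolding r_def by (metis linorder_neqE_nat)
    qed (simp_all add: harmonic_bounds less_imp_le gap_bounds gap_less)
    ultimately show "whiskered X \<alpha> (iprod_seq x1 e) \<in> N"
      using whiskered_homotopic iprod_seq_loop[OF e] by metis
  qed
  show ?thesis using inf_to_pair pair_to_tau tau_to_inf by blast
qed

end
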